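(* Let $X_1,X_2,\ldots,X_n,\ldots$ be a sequence of iid random variables with values in the ordered finite alphabet $\{\alpha_1<\alpha_2<\cdots<\alpha_m\}$ such that $\mathbb{P}(X_1=\alpha_r)=p_r$ for $r=1,\ldots,m$, where $0<p_r<1$ and $\sum_{r=1}^m p_r=1$. Let $LI_n$ be the length of the longest increasing subsequence of $X_1,\ldots,X_n$. Let $p_{max}=\max_{1\le r\le m}p_r$, $I^*=\{r\in\{1,\ldots,m\}: p_r<p_{max}\}$, and, for $1\le r\le m-1$, let $\mu_r=p_r-p_{r+1}$ and $\sigma_r>0$ with $\sigma_r^2=p_r+p_{r+1}-(p_r-p_{r+1})^2$. Then, as $n\to\infty$, $$\frac{LI_n-p_{max}n}{\sqrt n}\ \Rightarrow\ -\frac1m\sum_{i=1}^{m-1} i\,\sigma_i\tilde B^i(1)+\max_{\substack{0=t_0\le t_1\le\cdots\le t_{m-1}\le t_m=1\\ t_i=t_{i-1},\ i\in I^*}}\ \sum_{i=1}^{m-1}\sigma_i\tilde B^i(t_i),$$ where $(\tilde B^1(t),\dots,\tilde B^{m-1}(t))$, $0\le t\le1$, is an $(m-1)$-dimensional Brownian motion with covariance matrix $t(\rho_{r,s})_{1\le r,s\le m-1}$, where $\rho_{r,r}=1$ and, for $r\ne s$, $$\rho_{r,s}=\begin{cases}-\dfrac{p_r+\mu_r\mu_s}{\sigma_r\sigma_s}, & s=r-1,\\[2mm] -\dfrac{p_s+\mu_r\mu_s}{\sigma_r\sigma_s}, & s=r+1,\\[2mm] -\dfrac{\mu_r\mu_s}{\sigma_r\sigma_s},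 & |r-s|>1.\end{cases}$$
   Context: Increasing subsequences are understood in the weak (nondecreasing) sense: $LI_n$ is the largest $\ell$ for which there are indices $1\le i_1<\cdots<i_\ell\le n$ with $X_{i_1}\le\cdots\le X_{i_\ell}$. The symbol $\Rightarrow$ denotes convergence in distribution. A $d$-dimensional Brownian motion is a linear transformation of a standard multidimensional Brownian motion on $[0,1]$ started at $0$; saying it has covariance matrix $tM$ means that it is a centered Gaussian process with continuous paths and stationary independent increments whose value at time $t$ has covariance matrix $tM$. The maximum is over all $(t_1,\dots,t_{m-1})$ such that, with $t_0=0$ and $t_m=1$, the $t_i$ are nondecreasing and $t_i=t_{i-1}$ for every $i\in I^*$ (including $i=m$ if $m\in I^*$). *)

theory Defs
  imports "HOL-Probability.Probability"
begin

definition LI :: "(nat \<Rightarrow> 'c::linorder) \<Rightarrow> nat \<Rightarrow> nat" where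
  "LI x n = Max {l. \<exists>i::nat \<Rightarrow> nat. strict_mono_on {1..l} i \<and> i ` {1..l} \<subseteq> {1..n} \<and>
                      mono_on {1..l} (\<lambda>j. x (i j))}"

definition p_max :: "nat \<Rightarrow> (nat \<Rightarrow> real) \<Rightarrow> real" where
  "p_max m p = Max (p ` {1..m})"

definition I_star :: "nat \<Rightarrow> (nat \<Rightarrow> real) \<Rightarrow> nat set" where
  "I_star m p = {r \<in> {1..m}. p r < p_max m p}"

definition mu :: "(nat \<Rightarrow> real) \<Rightarrow> nat \<Rightarrow> real" where
  "mu p r = p r - p (r + 1)"

definition sigma :: "(nat \<Rightarrow> real) \<Rightarrow> nat \<Rightarrow> real" where
  "sigma p r = sqrt (p r + p (r + 1) - (p r - p (r + 1))\<^sup>2)"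

lemma sigma_pos:
  assumes "0 < p r" "p r < 1" "0 < p (r + 1)" "p (r + 1) < 1"
  shows "sigma p r > 0"
    and "(sigma p r)\<^sup>2 = p r + p (r + 1) - (p r - p (r + 1))\<^sup>2"
proof -
  have "(p r - p (r + 1))\<^sup>2 = \<bar>p r - p (r + 1)\<bar> * \<bar>p r - p (r + 1)\<bar>"
    by (simp add: power2_eq_square)
  also have "\<dots> \<le> \<bar>p r - p (r + 1)\<bar> * 1"
    using assms by (intro mult_left_mono) auto
  also have "\<dots> < p r + p (r + 1)"
    using assms by auto
  finally have *: "p r + p (r + 1) - (p r - p (r + 1))\<^sup>2 > 0"
    by simp
  then show "sigma p r > 0"
    and "(sigma p r)\<^sup>2 = p r + p (r + 1) - (p r - p (r + 1))\<^sup>2"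
    unfolding sigma_def by simp_all
qed

definition rho :: "(nat \<Rightarrow> real) \<Rightarrow> nat \<Rightarrow> nat \<Rightarrow> real" where
  "rho p r s =
     (if r = s then 1
      else if r = s + 1 then - (p r + mu p r * mu p s) / (sigma p r * sigma p s)
      else if s = r + 1 then - (p s + mu p r * mu p s) / (sigma p r * sigma p s)
      else - (mu p r * mu p s) / (sigma p r * sigma p s))"

text \<open>Degenerate (almost surely constant) variables count as Gaussian, so that processes with a
  singular covariance matrix, or started at a fixed point, are covered.\<close>

definition gaussian_rv :: "'b measure \<Rightarrow> ('b \<Rightarrow> real) \<Rightarrow> bool" where
  "gaussian_rv N Y \<longleftrightarrow> Y \<in> borel_measurable N \<and>
     ((\<exists>a s. s > 0 \<and> distributed N lborel Y (normal_density a s)) \<or> (\<exists>a. AE \<omega> in N. Y \<omega> = a))"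

text \<open>A process with component indices \<open>I\<close> and time set \<open>T\<close> is Gaussian if all finite linear
  combinations of its values are Gaussian, i.e. if its finite-dimensional distributions are
  jointly Gaussian.\<close>

definition centered_gaussian_process ::
  "'b measure \<Rightarrow> nat set \<Rightarrow> real set \<Rightarrow> (nat \<Rightarrow> real \<Rightarrow> 'b \<Rightarrow> real) \<Rightarrow> bool" where
  "centered_gaussian_process N I T B \<longleftrightarrow>
     (\<forall>J c. finite J \<and> J \<subseteq> I \<times> T \<longrightarrow> gaussian_rv N (\<lambda>\<omega>. \<Sum>(i, t)\<in>J. c i t * B i t \<omega>)) \<and>
     (\<forall>i\<in>I. \<forall>t\<in>T. prob_space.expectation N (B i t) = 0)"

definition covariance :: "'b measure \<Rightarrow> ('b \<Rightarrow> real) \<Rightarrow> ('b \<Rightarrow> real) \<Rightarrow> real" where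
  "covariance N Y Z =
     prob_space.expectation N (\<lambda>\<omega>. (Y \<omega> - prob_space.expectation N Y) * (Z \<omega> - prob_space.expectation N Z))"

definition increment ::
  "nat set \<Rightarrow> (nat \<Rightarrow> real \<Rightarrow> 'b \<Rightarrow> real) \<Rightarrow> real \<Rightarrow> real \<Rightarrow> 'b \<Rightarrow> nat \<Rightarrow> real" where
  "increment I B s t \<omega> = (\<lambda>i\<in>I. B i t \<omega> - B i s \<omega>)"

text \<open>Brownian motion \<open>(B i t)\<close>, \<open>i \<in> I\<close>, \<open>0 \<le> t \<le> 1\<close>, with covariance matrix \<open>t M\<close>. The components
  are indexed by a finite set \<open>I\<close> of naturals, and increments are random vectors in the product
  space over \<open>I\<close>; independence and stationarity refer to these vectors.\<close>

definition brownian_motion ::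
  "'b measure \<Rightarrow> nat set \<Rightarrow> (nat \<Rightarrow> nat \<Rightarrow> real) \<Rightarrow> (nat \<Rightarrow> real \<Rightarrow> 'b \<Rightarrow> real) \<Rightarrow> bool" where
  "brownian_motion N I M B \<longleftrightarrow>
     prob_space N \<and>
     centered_gaussian_process N I {0..1} B \<and>
     (\<forall>i\<in>I. AE \<omega> in N. B i 0 \<omega> = 0) \<and>
     (\<forall>i\<in>I. \<forall>\<omega>\<in>space N. continuous_on {0..1} (\<lambda>t. B i t \<omega>)) \<and>
     (\<forall>(n::nat) t. mono_on {0..n} t \<and> t ` {0..n} \<subseteq> {0..1} \<longrightarrow>
        prob_space.indep_vars N (\<lambda>_. \<Pi>\<^sub>M i\<in>I. borel) (\<lambda>k. increment I B (t k) (t (k + 1))) {..<n}) \<and>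
     (\<forall>s h. 0 \<le> s \<and> 0 \<le> h \<and> s + h \<le> 1 \<longrightarrow>
        distr N (\<Pi>\<^sub>M i\<in>I. borel) (increment I B s (s + h)) =
        distr N (\<Pi>\<^sub>M i\<in>I. borel) (increment I B 0 h)) \<and>
     (\<forall>i\<in>I. \<forall>j\<in>I. \<forall>t\<in>{0..1}. covariance N (B i t) (B j t) = t * M i j)"

definition time_points :: "nat \<Rightarrow> (nat \<Rightarrow> real) \<Rightarrow> (nat \<Rightarrow> real) set" where
  "time_points m p = {t. t 0 = 0 \<and> t m = 1 \<and> (\<forall>i\<in>{1..m}. t (i - 1) \<le> t i) \<and>
                         (\<forall>i\<in>I_star m p. t i = t (i - 1))}"

text \<open>The supremum is a maximum whenever the paths are continuous on \<open>{0..1}\<close>: only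
  \<open>t 0, \<dots>, t m\<close> matter, and these range over a nonempty compact set.\<close>

definition limit_rv ::
  "nat \<Rightarrow> (nat \<Rightarrow> real) \<Rightarrow> (nat \<Rightarrow> real \<Rightarrow> 'b \<Rightarrow> real) \<Rightarrow> 'b \<Rightarrow> real" where
  "limit_rv m p B \<omega> =
     - (1 / real m) * (\<Sum>i=1..m-1. real i * sigma p i * B i 1 \<omega>) +
     (SUP t\<in>time_points m p. \<Sum>i=1..m-1. sigma p i * B i (t i) \<omega>)"

end

theory Submission
  imports Defs "HOL-Real_Asymp.Real_Asymp"
begin

text \<open>
  The theorem is an invariance principle for a maximum, and it is proved by applying Lindeberg's swapping
  method directly to the maximum instead of the underlying random walks.

  A nondecreasing subsequence of letters is determined by the points \<open>k 1 \<le> \<dots> \<le> k (m - 1)\<close> at which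
  it passes from one letter to the next. Hence \<open>LI\<close> is a maximum over cuts \<open>k\<close> of a linear functional of the
  letter indicators (\<open>LI_eq_Max_cuts\<close>). After normalisation, \<open>LI_eq_cut_max\<close> writes it as a maximum of
  affine functionals of the iid steps \<open>letter_step\<close>, where a cut pays a penalty, of order \<open>sqrt n\<close>, for the share of
  the positions that it assigns to letters of less than maximal probability.

  The given Brownian motion supplies the Gaussian steps: its increments over the intervals of a grid of mesh
  \<open>1 / n\<close> are iid with the same mean and covariance as the letter steps, and for both the third moments are
  of order \<open>n powr (- 3 / 2)\<close>. By \<open>lindeberg_max\<close> the steps can be exchanged inside the maximum. There the
  maximum is smoothed to \<open>ln (\<Sum>k. exp (b * v k)) / b\<close>; when a single step is replaced, the first and second
  order terms of Taylor's formula agree, and the third order term is of order \<open>b\<^sup>2 * n powr (- 3 / 2)\<close>.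
  The number of cuts is polynomial in \<open>n\<close>, so the smoothing costs only \<open>O(ln n / b)\<close>, and a small power of \<open>n\<close>
  as \<open>b\<close> makes both errors vanish.

  It remains to pass to the limit in the same maximum for the Brownian motion, which is a statement about a
  fixed continuous path (\<open>penalised_grid_max_tendsto\<close>): the penalty, which grows like \<open>sqrt n\<close>, forces
  \<open>t i = t (i - 1)\<close> for \<open>i \<in> I_star m p\<close>, and continuity removes the grid. Taking \<open>cos (t * u)\<close> and \<open>sin (t * u)\<close>
  as test functions gives the convergence of the characteristic functions, and Levy's continuity theorem
  yields the claim.
\<close>

section \<open>Smooth maxima\<close>

text \<open>The maximum is not differentiable, so it is replaced by \<open>ln (\<Sum>k. exp (b * v k)) / b\<close>. The sum lies
  between its largest term and \<open>card K\<close> times that term, whence the price of the smoothing; it is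
  only logarithmic in the number of competitors.\<close>

lemma softmax_bounds:
  fixes v :: "'k \<Rightarrow> real"
  assumes K: "finite K" "K \<noteq> {}" and b: "0 < b"
  shows "\<bar>ln (\<Sum>k\<in>K. exp (b * v k)) / b - Max (v ` K)\<bar> \<le> ln (real (card K)) / b"
proof -
  let ?M = "Max (v ` K)" and ?S = "\<Sum>k\<in>K. exp (b * v k)"
  obtain k0 where k0: "k0 \<in> K" "v k0 = ?M"
    using Max_in[of "v ` K"] K by fastforce
  have lower: "exp (b * ?M) \<le> ?S"
    using member_le_sum[of k0 K "\<lambda>k. exp (b * v k)"] K k0 by simp
  have "?S \<le> (\<Sum>k\<in>K. exp (b * ?M))"
    using K b by (intro sum_mono) simp
  then have upper: "?S \<le> real (card K) * exp (b * ?M)"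
    by simp
  have c: "0 < real (card K)"
    using K by (simp add: card_gt_0_iff)
  have S: "0 < ?S"
    using lower by (rule less_le_trans[OF exp_gt_zero])
  have "b * ?M \<le> ln ?S"
    using lower S by (simp add: ln_ge_iff)
  moreover have "ln ?S \<le> ln (real (card K)) + b * ?M"
  proof -
    have "ln ?S \<le> ln (real (card K) * exp (b * ?M))"
      using upper S by simp
    also have "\<dots> = ln (real (card K)) + b * ?M"
      using c by (simp add: ln_mult)
    finally show ?thesis .
  qed
  ultimately show ?thesis
    using b by (simp add: abs_le_iff divide_simps) (simp add: algebra_simps)
qed

text \<open>Along a line \<open>s \<mapsto> s * l\<close> the derivatives of the smooth maximum are, up to powers of \<open>b\<close>, the cumulants
  of \<open>l\<close> under the Gibbs weights \<open>w k * exp (b * s * l k)\<close>: the \<open>q\<close>-th derivative carries the factor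
  \<open>b ^ (q - 1)\<close> and is bounded by a multiple of \<open>M ^ q\<close>, independently of the number of competitors. The
  estimate is Taylor's formula at \<open>s = 1\<close>. The constant comes from the third derivative of the composition
  with \<open>f\<close>: its three terms contribute \<open>1\<close>, \<open>3 * 2\<close> and \<open>6\<close> times \<open>L * b\<^sup>2 * M ^ 3\<close>, and \<open>13 / 6 \<le> 3\<close>.\<close>

lemma softmax_line_expansion:
  fixes w l :: "'k \<Rightarrow> real" and f f1 f2 f3 :: "real \<Rightarrow> real"
  assumes K: "finite K" "K \<noteq> {}" and w: "\<And>k. k \<in> K \<Longrightarrow> 0 < w k"
    and l: "\<And>k. k \<in> K \<Longrightarrow> \<bar>l k\<bar> \<le> M"
    and f: "\<And>u. (f has_real_derivative f1 u) (at u)"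
      "\<And>u. (f1 has_real_derivative f2 u) (at u)"
      "\<And>u. (f2 has_real_derivative f3 u) (at u)"
    and L: "\<And>u. \<bar>f1 u\<bar> \<le> L" "\<And>u. \<bar>f2 u\<bar> \<le> L" "\<And>u. \<bar>f3 u\<bar> \<le> L"
    and b: "1 \<le> b"
  defines "W \<equiv> \<Sum>k\<in>K. w k"
  defines "u0 \<equiv> ln W / b"
  defines "e1 \<equiv> (\<Sum>k\<in>K. w k * l k) / W"
  defines "e2 \<equiv> (\<Sum>k\<in>K. w k * (l k)\<^sup>2) / W"
  shows "\<bar>f (ln (\<Sum>k\<in>K. w k * exp (b * l k)) / b) - f u0 - f1 u0 * e1
           - (f2 u0 * e1\<^sup>2 + f1 u0 * (b * (e2 - e1\<^sup>2))) / 2\<bar> \<le> 3 * L * b\<^sup>2 * M ^ 3"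
proof -
  \<comment> \<open>\<open>e q s\<close> is the \<open>q\<close>-th moment of \<open>l\<close> under the Gibbs weights at \<open>s\<close>; these moments are closed under differentiation.\<close>
  define S where "S q s = (\<Sum>k\<in>K. w k * l k ^ q * exp (b * s * l k))" for q :: nat and s :: real
  define e where "e q s = S q s / S 0 s" for q s
  define F where "F s = ln (S 0 s) / b" for s
  have S0: "0 < S 0 s" for s
    unfolding S_def using K w by (intro sum_pos) auto
  have M0: "0 \<le> M"
    using K l by (meson abs_ge_zero ex_in_conv order_trans)
  have L0: "0 \<le> L"
    using L(1) by (meson abs_ge_zero order_trans)
  have dS: "(S q has_real_derivative b * S (Suc q) s) (at s)" for q s
    unfolding S_def
    by (auto intro!: derivative_eq_intros sum.cong simp: sum_distrib_left algebra_simps)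
  have de: "(e q has_real_derivative b * (e (Suc q) s - e q s * e 1 s)) (at s)" for q s
  proof -
    have "((\<lambda>s. S q s / S 0 s) has_real_derivative
        (b * S (Suc q) s * S 0 s - S q s * (b * S (Suc 0) s)) / (S 0 s * S 0 s)) (at s)"
      using S0[of s] by (intro DERIV_divide dS) auto
    moreover have "(b * S (Suc q) s * S 0 s - S q s * (b * S (Suc 0) s)) / (S 0 s * S 0 s)
        = b * (e (Suc q) s - e q s * e 1 s)"
      using S0[of s] by (simp add: e_def field_simps)
    ultimately show ?thesis
      unfolding e_def[abs_def] by simp
  qed
  have dF: "(F has_real_derivative e 1 s) (at s)" for s
  proof -
    have "((\<lambda>s. ln (S 0 s) / b) has_real_derivative (inverse (S 0 s) * (b * S (Suc 0) s)) / b) (at s)"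
      using S0[of s] by (intro DERIV_cdivide DERIV_chain2[OF DERIV_ln dS]) auto
    then show ?thesis
      unfolding F_def[abs_def] using b by (simp add: e_def field_simps)
  qed
  have ebound: "\<bar>e q s\<bar> \<le> M ^ q" for q s
  proof -
    have "\<bar>S q s\<bar> \<le> (\<Sum>k\<in>K. \<bar>w k * l k ^ q * exp (b * s * l k)\<bar>)"
      unfolding S_def by (rule sum_abs)
    also have "\<dots> \<le> (\<Sum>k\<in>K. M ^ q * (w k * l k ^ 0 * exp (b * s * l k)))"
      using w l M0
      by (intro sum_mono) (auto simp: abs_mult power_abs less_imp_le
          intro!: mult_mono power_mono mult_nonneg_nonneg order_trans[OF eq_refl[OF mult.commute]])
    also have "\<dots> = M ^ q * S 0 s"
      unfolding S_def by (rule sum_distrib_left[symmetric])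
    finally show ?thesis
      using S0[of s] by (simp add: e_def field_simps)
  qed
  define F2 where "F2 s = b * (e 2 s - e 1 s * e 1 s)" for s
  define F3 where "F3 s = b * (b * (e 3 s - e 2 s * e 1 s)
      - 2 * (e 1 s * (b * (e 2 s - e 1 s * e 1 s))))" for s
  have dF1: "(e 1 has_real_derivative F2 s) (at s)" for s
    using de[of 1 s] by (simp add: F2_def numeral_2_eq_2)
  have dF2: "(F2 has_real_derivative F3 s) (at s)" for s
    unfolding F2_def[abs_def] F3_def
    by (rule derivative_eq_intros de[of 1] de[of 2] refl)+
       (simp add: numeral_2_eq_2 numeral_3_eq_3)
  define D where "D i = (case i of
      0 \<Rightarrow> (\<lambda>s. f (F s))
    | Suc 0 \<Rightarrow> (\<lambda>s. f1 (F s) * e 1 s)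
    | Suc (Suc 0) \<Rightarrow> (\<lambda>s. f2 (F s) * e 1 s * e 1 s + f1 (F s) * F2 s)
    | _ \<Rightarrow> (\<lambda>s. f3 (F s) * e 1 s * e 1 s * e 1 s + 3 * f2 (F s) * e 1 s * F2 s + f1 (F s) * F3 s))"
    for i :: nat
  have df: "((\<lambda>s. f (F s)) has_real_derivative f1 (F s) * e 1 s) (at s)"
    "((\<lambda>s. f1 (F s)) has_real_derivative f2 (F s) * e 1 s) (at s)"
    "((\<lambda>s. f2 (F s)) has_real_derivative f3 (F s) * e 1 s) (at s)" for s
    by (rule DERIV_chain2[OF f(1) dF] DERIV_chain2[OF f(2) dF] DERIV_chain2[OF f(3) dF])+
  have "(D i has_real_derivative D (Suc i) s) (at s)" if i3: "i < 3" for i s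
  proof -
    consider "i = 0" | "i = Suc 0" | "i = Suc (Suc 0)"
      using i3 by linarith
    then show ?thesis
    proof cases
      case 1 then show ?thesis using df(1) by (simp add: D_def)
    next
      case 2
      have "((\<lambda>s. f1 (F s) * e 1 s) has_real_derivative
          f2 (F s) * e 1 s * e 1 s + f1 (F s) * F2 s) (at s)"
        by (rule derivative_eq_intros df(2) dF1 refl)+ simp
      then show ?thesis using 2 by (simp add: D_def)
    next
      case 3
      have "((\<lambda>s. f2 (F s) * e 1 s * e 1 s + f1 (F s) * F2 s) has_real_derivative
          f3 (F s) * e 1 s * e 1 s * e 1 s + 3 * f2 (F s) * e 1 s * F2 s + f1 (F s) * F3 s) (at s)"
        by (rule derivative_eq_intros df(2,3) dF1 dF2 refl)+ (simp add: algebra_simps)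
      then show ?thesis using 3 by (simp add: D_def)
    qed
  qed
  then obtain \<xi> where \<xi>: "f (F 1) = (\<Sum>i<3. D i 0 / fact i * 1 ^ i) + D 3 \<xi> / fact 3 * 1 ^ 3"
    using Maclaurin[of 1 3 D "\<lambda>s. f (F s)"] by (auto simp: D_def)
  have e1: "\<bar>e 1 \<xi>\<bar> \<le> M" and e2: "\<bar>e 2 \<xi>\<bar> \<le> M ^ 2" and e3: "\<bar>e 3 \<xi>\<bar> \<le> M ^ 3"
    using ebound[of 1 \<xi>] ebound[of 2 \<xi>] ebound[of 3 \<xi>] by auto
  have e11: "\<bar>e 1 \<xi> * e 1 \<xi>\<bar> \<le> M ^ 2"
    using mult_mono[OF e1 e1 M0] by (simp add: abs_mult power2_eq_square)
  have e21: "\<bar>e 2 \<xi> * e 1 \<xi>\<bar> \<le> M ^ 3"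
    using mult_mono[OF e2 e1] M0 by (simp add: abs_mult power2_eq_square power3_eq_cube)
  have v: "\<bar>e 2 \<xi> - e 1 \<xi> * e 1 \<xi>\<bar> \<le> 2 * M ^ 2"
    using e2 e11 by linarith
  have ve: "\<bar>e 1 \<xi> * (e 2 \<xi> - e 1 \<xi> * e 1 \<xi>)\<bar> \<le> 2 * M ^ 3"
    using mult_mono[OF e1 v] M0 by (simp add: abs_mult power2_eq_square power3_eq_cube)
  have b2: "b \<le> b\<^sup>2" "1 \<le> b\<^sup>2"
    using power_increasing[OF _ b, of 1 2] one_le_power[OF b, of 2] by auto
  have F3b: "\<bar>F3 \<xi>\<bar> \<le> 6 * M ^ 3 * b\<^sup>2"
  proof -
    have "F3 \<xi> = (e 3 \<xi> - e 2 \<xi> * e 1 \<xi> - 2 * (e 1 \<xi> * (e 2 \<xi> - e 1 \<xi> * e 1 \<xi>))) * b\<^sup>2"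
      by (simp add: F3_def power2_eq_square algebra_simps)
    moreover have "\<bar>e 3 \<xi> - e 2 \<xi> * e 1 \<xi> - 2 * (e 1 \<xi> * (e 2 \<xi> - e 1 \<xi> * e 1 \<xi>))\<bar> \<le> 6 * M ^ 3"
      using e3 e21 ve by linarith
    ultimately show ?thesis
      by (simp add: abs_mult mult_right_mono)
  qed
  have t1: "\<bar>f3 (F \<xi>) * (e 1 \<xi> * e 1 \<xi> * e 1 \<xi>)\<bar> \<le> L * (M ^ 3 * b\<^sup>2)"
  proof -
    have "\<bar>e 1 \<xi> * e 1 \<xi> * e 1 \<xi>\<bar> \<le> M ^ 3"
      using mult_mono[OF e11 e1] M0 by (simp add: abs_mult power2_eq_square power3_eq_cube)
    also have "\<dots> \<le> M ^ 3 * b\<^sup>2"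
      using M0 b2 by (simp add: mult_le_cancel_left1)
    finally show ?thesis
      using L(3)[of "F \<xi>"] L0 unfolding abs_mult[of "f3 _"] by (intro mult_mono) auto
  qed
  have t2: "\<bar>f2 (F \<xi>) * (e 1 \<xi> * F2 \<xi>)\<bar> \<le> L * (2 * M ^ 3 * b\<^sup>2)"
  proof -
    have "\<bar>e 1 \<xi> * F2 \<xi>\<bar> = \<bar>e 1 \<xi> * (e 2 \<xi> - e 1 \<xi> * e 1 \<xi>)\<bar> * b"
      using b by (simp add: F2_def abs_mult)
    also have "\<dots> \<le> 2 * M ^ 3 * b\<^sup>2"
      using ve b b2 M0 by (intro mult_mono) auto
    finally show ?thesis
      using L(2)[of "F \<xi>"] L0 unfolding abs_mult[of "f2 _"] by (intro mult_mono) auto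
  qed
  have t3: "\<bar>f1 (F \<xi>) * F3 \<xi>\<bar> \<le> L * (6 * M ^ 3 * b\<^sup>2)"
    using L(1)[of "F \<xi>"] L0 F3b unfolding abs_mult by (intro mult_mono) auto
  have "D 3 \<xi> = f3 (F \<xi>) * (e 1 \<xi> * e 1 \<xi> * e 1 \<xi>) + 3 * (f2 (F \<xi>) * (e 1 \<xi> * F2 \<xi>)) + f1 (F \<xi>) * F3 \<xi>"
    by (simp add: D_def numeral_3_eq_3 algebra_simps)
  then have D3: "\<bar>D 3 \<xi>\<bar> \<le> 13 * (L * b\<^sup>2 * M ^ 3)"
    using t1 t2 t3 by (simp add: algebra_simps)
  have S00: "S q 0 = (\<Sum>k\<in>K. w k * l k ^ q)" for q
    by (simp add: S_def)
  have z: "F 0 = u0" "e (Suc 0) 0 = e1" "e (Suc (Suc 0)) 0 = e2"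
    by (simp_all add: F_def u0_def e_def e1_def e2_def W_def S00 power2_eq_square)
  have Dz: "(\<Sum>i<3. D i 0 / fact i * 1 ^ i)
      = f u0 + f1 u0 * e1 + (f2 u0 * e1\<^sup>2 + f1 u0 * (b * (e2 - e1\<^sup>2))) / 2"
    by (simp add: D_def F2_def z eval_nat_numeral mult.assoc)
  have F1: "F 1 = ln (\<Sum>k\<in>K. w k * exp (b * l k)) / b"
    by (simp add: F_def S_def)
  have "f (F 1) - f u0 - f1 u0 * e1 - (f2 u0 * e1\<^sup>2 + f1 u0 * (b * (e2 - e1\<^sup>2))) / 2 = D 3 \<xi> / 6"
    using \<xi> unfolding Dz by (simp add: fact_numeral)
  moreover have "\<bar>D 3 \<xi> / 6\<bar> \<le> 3 * (L * b\<^sup>2 * M ^ 3)"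
    using D3 L0 M0 by auto
  ultimately show ?thesis
    unfolding F1 by (simp only: mult.assoc)
qed

section \<open>Lindeberg's method for maxima\<close>

text \<open>The hybrid measures \<open>Q k\<close> use \<open>\<nu>\<close> in the first \<open>k\<close> coordinates and \<open>\<mu>\<close> in the others. Consecutive hybrids
  differ in one coordinate only; integrating this coordinate first, with all others held fixed, turns the
  difference into an average of the differences bounded by \<open>swap\<close>.\<close>

lemma product_measure_swap:
  fixes \<mu> \<nu> :: "'x measure" and G :: "(nat \<Rightarrow> 'x) \<Rightarrow> real"
  assumes \<mu>: "prob_space \<mu>" and \<nu>: "prob_space \<nu>" and sets: "sets \<nu> = sets \<mu>"
    and G: "G \<in> borel_measurable (\<Pi>\<^sub>M j\<in>{..<n}. \<mu>)" and bound: "\<And>x. \<bar>G x\<bar> \<le> C"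
    and swap: "\<And>j x. j < n \<Longrightarrow>
      \<bar>(\<integral>y. G (x(j := y)) \<partial>\<mu>) - (\<integral>y. G (x(j := y)) \<partial>\<nu>)\<bar> \<le> \<epsilon>"
  shows "\<bar>(\<integral>x. G x \<partial>(\<Pi>\<^sub>M j\<in>{..<n}. \<mu>)) - (\<integral>x. G x \<partial>(\<Pi>\<^sub>M j\<in>{..<n}. \<nu>))\<bar> \<le> real n * \<epsilon>"
proof -
  define M where "M k j = (if j < k then \<nu> else \<mu>)" for k j :: nat
  define Q where "Q k = (\<integral>x. G x \<partial>(\<Pi>\<^sub>M j\<in>{..<n}. M k j))" for k
  have M: "prob_space (M k j)" and setsM: "sets (M k j) = sets \<mu>" for k j
    using \<mu> \<nu> sets by (auto simp: M_def)
  have GM: "G \<in> borel_measurable (\<Pi>\<^sub>M j\<in>{..<n}. M k j)" for k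
    using G by (subst measurable_cong_sets[OF sets_PiM_cong refl]) (auto simp: setsM)
  have step: "\<bar>Q k - Q (Suc k)\<bar> \<le> \<epsilon>" if k: "k < n" for k
  proof -
    define J where "J = {..<n} - {k}"
    have J: "finite J" "k \<notin> J" and ins: "insert k J = {..<n}"
      using k by (auto simp: J_def)
    have split: "Q i = (\<integral>x. (\<integral>y. G (x(k := y)) \<partial>M i k) \<partial>(\<Pi>\<^sub>M j\<in>J. M k j))"
      and integ: "integrable (\<Pi>\<^sub>M j\<in>J. M k j) (\<lambda>x. \<integral>y. G (x(k := y)) \<partial>M i k)"
      if i: "i = k \<or> i = Suc k" for i
    proof -
      interpret Mi: product_sigma_finite "M i"
        by (intro product_sigma_finite.intro prob_space_imp_sigma_finite M)
      interpret PJ: prob_space "\<Pi>\<^sub>M j\<in>J. M i j"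
        by (rule prob_space_PiM) (rule M)
      interpret PI: prob_space "\<Pi>\<^sub>M j\<in>{..<n}. M i j"
        by (rule prob_space_PiM) (rule M)
      interpret Mik: prob_space "M i k"
        by (rule M)
      have int: "integrable (\<Pi>\<^sub>M j\<in>{..<n}. M i j) G"
        using bound by (intro PI.integrable_const_bound[of _ C] GM) auto
      have cong: "(\<Pi>\<^sub>M j\<in>J. M i j) = (\<Pi>\<^sub>M j\<in>J. M k j)"
        using i by (intro PiM_cong) (auto simp: M_def J_def)
      show "Q i = (\<integral>x. (\<integral>y. G (x(k := y)) \<partial>M i k) \<partial>(\<Pi>\<^sub>M j\<in>J. M k j))"
        unfolding Q_def cong[symmetric]
        using Mi.product_integral_insert[OF J, of G] int by (simp add: ins)
      have "(\<lambda>(x, y). x(k := y)) \<in> (\<Pi>\<^sub>M j\<in>J. M i j) \<Otimes>\<^sub>M M i k \<rightarrow>\<^sub>M (\<Pi>\<^sub>M j\<in>{..<n}. M i j)"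
        using measurable_add_dim[of k J "M i"] by (simp add: ins)
      then have "(\<lambda>(x, y). G (x(k := y))) \<in> borel_measurable ((\<Pi>\<^sub>M j\<in>J. M i j) \<Otimes>\<^sub>M M i k)"
        using measurable_compose[OF _ GM[of i]] by (simp add: case_prod_beta')
      then have "(\<lambda>x. \<integral>y. G (x(k := y)) \<partial>M i k) \<in> borel_measurable (\<Pi>\<^sub>M j\<in>J. M i j)"
        by (rule sigma_finite_measure.borel_measurable_lebesgue_integral[OF prob_space_imp_sigma_finite[OF M]])
      moreover have "\<bar>\<integral>y. G (x(k := y)) \<partial>M i k\<bar> \<le> C" for x
      proof -
        have "C \<ge> 0"
          using bound[of x] by linarith
        then have "(\<integral>y. \<bar>G (x(k := y))\<bar> \<partial>M i k) \<le> (\<integral>y. C \<partial>M i k)"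
          using bound by (intro integral_mono') auto
        from order_trans[OF integral_abs_bound this] show ?thesis
          by (simp add: Mik.prob_space)
      qed
      ultimately show "integrable (\<Pi>\<^sub>M j\<in>J. M k j) (\<lambda>x. \<integral>y. G (x(k := y)) \<partial>M i k)"
        unfolding cong[symmetric] by (intro PJ.integrable_const_bound[of _ C]) auto
    qed
    interpret PJ: prob_space "\<Pi>\<^sub>M j\<in>J. M k j"
      by (rule prob_space_PiM) (rule M)
    let ?d = "\<lambda>x. (\<integral>y. G (x(k := y)) \<partial>M k k) - (\<integral>y. G (x(k := y)) \<partial>M (Suc k) k)"
    have d: "\<bar>?d x\<bar> \<le> \<epsilon>" for x
      using swap[OF k, of x] by (simp add: M_def)
    have "\<bar>Q k - Q (Suc k)\<bar> = \<bar>\<integral>x. ?d x \<partial>(\<Pi>\<^sub>M j\<in>J. M k j)\<bar>"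
      by (simp add: split[of k] split[of "Suc k"] integ Bochner_Integration.integral_diff)
    also have "\<dots> \<le> (\<integral>x. \<bar>?d x\<bar> \<partial>(\<Pi>\<^sub>M j\<in>J. M k j))"
      by (rule integral_abs_bound)
    also have "\<dots> \<le> (\<integral>x. \<epsilon> \<partial>(\<Pi>\<^sub>M j\<in>J. M k j))"
      using d by (intro integral_mono integrable_abs Bochner_Integration.integrable_diff integ) auto
    also have "\<dots> = \<epsilon>"
      by (simp add: PJ.prob_space)
    finally show ?thesis .
  qed
  have "\<bar>Q 0 - Q k\<bar> \<le> real k * \<epsilon>" if "k \<le> n" for k
    using that
  proof (induction k)
    case (Suc k)
    then show ?case
      using step[of k] by (simp add: algebra_simps)
  qed simp
  from this[of n] have "\<bar>Q 0 - Q n\<bar> \<le> real n * \<epsilon>"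
    by simp
  moreover have "(\<Pi>\<^sub>M j\<in>{..<n}. M n j) = (\<Pi>\<^sub>M j\<in>{..<n}. \<nu>)"
    by (intro PiM_cong) (auto simp: M_def)
  ultimately show ?thesis
    by (simp add: Q_def M_def)
qed

text \<open>A function that is a quadratic polynomial up to a cubic error has an integral that depends, up to the
  third moment, on the first two moments of the measure alone. Two measures which share these moments
  therefore give nearly the same integral.\<close>

lemma integral_quadratic_expansion:
  fixes h :: "('i \<Rightarrow> real) \<Rightarrow> real"
  assumes I: "finite I" and \<mu>: "prob_space \<mu>" and sets: "sets \<mu> = sets (\<Pi>\<^sub>M i\<in>I. borel)"
    and h: "integrable \<mu> h"
    and third: "integrable \<mu> (\<lambda>y. (\<Sum>i\<in>I. \<bar>y i\<bar>) ^ 3)" "(\<integral>y. (\<Sum>i\<in>I. \<bar>y i\<bar>) ^ 3 \<partial>\<mu>) \<le> \<tau>"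
    and exp: "\<And>y. \<bar>h y - c0 - (\<Sum>i\<in>I. c i * y i) - (\<Sum>i\<in>I. \<Sum>j\<in>I. d i j * (y i * y j))\<bar>
                  \<le> R * (\<Sum>i\<in>I. \<bar>y i\<bar>) ^ 3" and R: "0 \<le> R"
  shows "\<bar>(\<integral>y. h y \<partial>\<mu>) - (c0 + (\<Sum>i\<in>I. c i * (\<integral>y. y i \<partial>\<mu>))
           + (\<Sum>i\<in>I. \<Sum>j\<in>I. d i j * (\<integral>y. y i * y j \<partial>\<mu>)))\<bar> \<le> R * \<tau>"
proof -
  interpret prob_space \<mu> by fact
  let ?s = "\<lambda>y. \<Sum>i\<in>I. \<bar>y i\<bar>"
  have meas[measurable]: "(\<lambda>y. y i) \<in> borel_measurable \<mu>" if "i \<in> I" for i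
    using that by (subst measurable_cong_sets[OF sets refl]) simp
  have le: "\<bar>y i\<bar> \<le> ?s y" if "i \<in> I" for y :: "'i \<Rightarrow> real" and i
    using member_le_sum[of i I "\<lambda>i. \<bar>y i\<bar>"] that I by simp
  have s0: "0 \<le> ?s y" for y :: "'i \<Rightarrow> real"
    by (simp add: sum_nonneg)
  \<comment> \<open>The third moment dominates the lower ones, which gives the integrability of the quadratic polynomial.\<close>
  have cube: "t \<le> 1 + t ^ 3" "t\<^sup>2 \<le> 1 + t ^ 3" if "0 \<le> t" for t :: real
  proof -
    have "t \<le> t ^ 3 \<and> t\<^sup>2 \<le> t ^ 3" if "1 \<le> t"
      using that power_increasing[of 1 3 t] power_increasing[of 2 3 t] by simp
    moreover have "t \<le> 1 \<and> t\<^sup>2 \<le> 1" if "t \<le> 1"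
      using that \<open>0 \<le> t\<close> by (simp add: power_le_one)
    ultimately show "t \<le> 1 + t ^ 3" "t\<^sup>2 \<le> 1 + t ^ 3"
      using \<open>0 \<le> t\<close> zero_le_power[of t 3] by (smt (verit))+
  qed
  have dom: "integrable \<mu> (\<lambda>y. 1 + ?s y ^ 3)"
    using third by simp
  have i1: "integrable \<mu> (\<lambda>y. y i)" if i: "i \<in> I" for i
  proof (rule Bochner_Integration.integrable_bound[OF dom])
    show "AE y in \<mu>. norm (y i) \<le> norm (1 + ?s y ^ 3)"
    proof (rule AE_I2)
      fix y :: "'i \<Rightarrow> real"
      show "norm (y i) \<le> norm (1 + ?s y ^ 3)"
        using le[OF i, of y] cube(1)[OF s0[of y]] zero_le_power[OF s0[of y], of 3] by simp
    qed
  qed (use i in measurable)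
  have i2: "integrable \<mu> (\<lambda>y. y i * y j)" if i: "i \<in> I" "j \<in> I" for i j
  proof (rule Bochner_Integration.integrable_bound[OF dom])
    show "AE y in \<mu>. norm (y i * y j) \<le> norm (1 + ?s y ^ 3)"
    proof (rule AE_I2)
      fix y :: "'i \<Rightarrow> real"
      have "\<bar>y i\<bar> * \<bar>y j\<bar> \<le> ?s y * ?s y"
        using le i s0[of y] by (intro mult_mono) auto
      then show "norm (y i * y j) \<le> norm (1 + ?s y ^ 3)"
        using cube(2)[OF s0[of y]] zero_le_power[OF s0[of y], of 3]
        by (simp add: abs_mult power2_eq_square)
    qed
  qed (use i in measurable)
  let ?q = "\<lambda>y. (\<Sum>i\<in>I. c i * y i) + (\<Sum>i\<in>I. \<Sum>j\<in>I. d i j * (y i * y j))"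
  have q: "integrable \<mu> ?q"
    using i1 i2 by auto
  have "(\<integral>y. h y - c0 - ?q y \<partial>\<mu>) = (\<integral>y. h y \<partial>\<mu>) - c0 - (\<integral>y. ?q y \<partial>\<mu>)"
    using h q by (simp add: prob_space)
  also have "(\<integral>y. ?q y \<partial>\<mu>) = (\<Sum>i\<in>I. c i * (\<integral>y. y i \<partial>\<mu>))
           + (\<Sum>i\<in>I. \<Sum>j\<in>I. d i j * (\<integral>y. y i * y j \<partial>\<mu>))"
    using i1 i2 by (simp add: Bochner_Integration.integral_sum)
  finally have eq: "(\<integral>y. h y \<partial>\<mu>) - (c0 + (\<Sum>i\<in>I. c i * (\<integral>y. y i \<partial>\<mu>))
           + (\<Sum>i\<in>I. \<Sum>j\<in>I. d i j * (\<integral>y. y i * y j \<partial>\<mu>))) = (\<integral>y. h y - c0 - ?q y \<partial>\<mu>)"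
    by simp
  have "\<bar>\<integral>y. h y - c0 - ?q y \<partial>\<mu>\<bar> \<le> (\<integral>y. \<bar>h y - c0 - ?q y\<bar> \<partial>\<mu>)"
    by (rule integral_abs_bound)
  also have "\<dots> \<le> (\<integral>y. R * ?s y ^ 3 \<partial>\<mu>)"
  proof (rule integral_mono)
    show "integrable \<mu> (\<lambda>y. \<bar>h y - c0 - ?q y\<bar>)"
      using h q by (intro integrable_abs Bochner_Integration.integrable_diff) auto
    show "\<bar>h y - c0 - ?q y\<bar> \<le> R * ?s y ^ 3" for y
      using exp[of y] by (simp add: diff_diff_eq add.assoc)
  qed (use third in simp)
  also have "\<dots> \<le> R * \<tau>"
    using third R by (simp add: mult_left_mono)
  finally show ?thesis
    unfolding eq .
qed

text \<open>In a single step \<open>y\<close>, each competitor is an affine function with slope \<open>a k\<close>; here the expansion along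
  the line through \<open>y\<close> is rewritten as a quadratic polynomial in the coordinates of \<open>y\<close>. The coefficients
  are the Gibbs mean \<open>\<alpha>\<close> and the Gibbs second moments \<open>\<gamma>\<close> of the slopes.\<close>

lemma softmax_swap_expansion:
  fixes a :: "'k \<Rightarrow> 'i \<Rightarrow> real" and g :: "'k \<Rightarrow> real"
  assumes I: "finite I" and K: "finite K" "K \<noteq> {}"
    and A: "\<And>k i. k \<in> K \<Longrightarrow> i \<in> I \<Longrightarrow> \<bar>a k i\<bar> \<le> A"
    and f: "\<And>u. (f has_real_derivative f1 u) (at u)"
      "\<And>u. (f1 has_real_derivative f2 u) (at u)"
      "\<And>u. (f2 has_real_derivative f3 u) (at u)"
    and L: "\<And>u. \<bar>f1 u\<bar> \<le> L" "\<And>u. \<bar>f2 u\<bar> \<le> L" "\<And>u. \<bar>f3 u\<bar> \<le> L"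
    and b: "1 \<le> b"
  shows "\<exists>c0 c d. \<forall>y. \<bar>f (ln (\<Sum>k\<in>K. exp (b * (g k + (\<Sum>i\<in>I. a k i * y i)))) / b)
             - c0 - (\<Sum>i\<in>I. c i * y i) - (\<Sum>i\<in>I. \<Sum>j\<in>I. d i j * (y i * y j))\<bar>
           \<le> 3 * L * b\<^sup>2 * A ^ 3 * (\<Sum>i\<in>I. \<bar>y i\<bar>) ^ 3"
proof -
  define w where "w k = exp (b * g k)" for k
  define W where "W = (\<Sum>k\<in>K. w k)"
  define u where "u = ln W / b"
  define \<alpha> where "\<alpha> i = (\<Sum>k\<in>K. w k * a k i) / W" for i
  define \<gamma> where "\<gamma> i j = (\<Sum>k\<in>K. w k * (a k i * a k j)) / W" for i j
  define d where "d i j = (f2 u * (\<alpha> i * \<alpha> j) + f1 u * (b * (\<gamma> i j - \<alpha> i * \<alpha> j))) / 2" for i j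
  have w_pos: "0 < w k" for k
    by (simp add: w_def)
  have "\<bar>f (ln (\<Sum>k\<in>K. exp (b * (g k + (\<Sum>i\<in>I. a k i * y i)))) / b)
             - f u - (\<Sum>i\<in>I. f1 u * \<alpha> i * y i) - (\<Sum>i\<in>I. \<Sum>j\<in>I. d i j * (y i * y j))\<bar>
           \<le> 3 * L * b\<^sup>2 * A ^ 3 * (\<Sum>i\<in>I. \<bar>y i\<bar>) ^ 3" for y
  proof -
    let ?l = "\<lambda>k. \<Sum>i\<in>I. a k i * y i"
    have l: "\<bar>?l k\<bar> \<le> A * (\<Sum>i\<in>I. \<bar>y i\<bar>)" if "k \<in> K" for k
    proof -
      have "\<bar>?l k\<bar> \<le> (\<Sum>i\<in>I. \<bar>a k i * y i\<bar>)"
        by (rule sum_abs)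
      also have "\<dots> \<le> (\<Sum>i\<in>I. A * \<bar>y i\<bar>)"
        using A that by (intro sum_mono) (simp add: abs_mult mult_right_mono)
      finally show ?thesis
        by (simp add: sum_distrib_left)
    qed
    have e1: "(\<Sum>k\<in>K. w k * ?l k) / W = (\<Sum>i\<in>I. \<alpha> i * y i)"
    proof -
      have "(\<Sum>k\<in>K. w k * ?l k) = (\<Sum>i\<in>I. \<Sum>k\<in>K. w k * a k i * y i)"
        unfolding sum_distrib_left by (subst sum.swap) (simp add: mult.assoc)
      then show ?thesis
        by (simp add: \<alpha>_def sum_divide_distrib sum_distrib_right)
    qed
    have e2: "(\<Sum>k\<in>K. w k * (?l k)\<^sup>2) / W = (\<Sum>i\<in>I. \<Sum>j\<in>I. \<gamma> i j * (y i * y j))"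
    proof -
      have "(\<Sum>k\<in>K. w k * (?l k)\<^sup>2) = (\<Sum>k\<in>K. \<Sum>i\<in>I. \<Sum>j\<in>I. w k * (a k i * a k j) * (y i * y j))"
        by (simp add: power2_eq_square sum_product sum_distrib_left mult_ac)
      also have "\<dots> = (\<Sum>i\<in>I. \<Sum>k\<in>K. \<Sum>j\<in>I. w k * (a k i * a k j) * (y i * y j))"
        by (rule sum.swap)
      also have "\<dots> = (\<Sum>i\<in>I. \<Sum>j\<in>I. \<Sum>k\<in>K. w k * (a k i * a k j) * (y i * y j))"
        by (intro sum.cong refl sum.swap)
      finally show ?thesis
        by (simp add: \<gamma>_def sum_divide_distrib sum_distrib_right)
    qed
    have sq: "(\<Sum>i\<in>I. \<alpha> i * y i)\<^sup>2 = (\<Sum>i\<in>I. \<Sum>j\<in>I. \<alpha> i * \<alpha> j * (y i * y j))"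
      by (simp add: power2_eq_square sum_product mult_ac)
    have "(\<Sum>k\<in>K. exp (b * (g k + ?l k))) = (\<Sum>k\<in>K. w k * exp (b * ?l k))"
      by (simp add: w_def distrib_left exp_add)
    moreover have "\<bar>f (ln (\<Sum>k\<in>K. w k * exp (b * ?l k)) / b) - f u - f1 u * (\<Sum>i\<in>I. \<alpha> i * y i)
        - (f2 u * (\<Sum>i\<in>I. \<alpha> i * y i)\<^sup>2 + f1 u * (b * ((\<Sum>i\<in>I. \<Sum>j\<in>I. \<gamma> i j * (y i * y j))
        - (\<Sum>i\<in>I. \<alpha> i * y i)\<^sup>2))) / 2\<bar> \<le> 3 * L * b\<^sup>2 * (A * (\<Sum>i\<in>I. \<bar>y i\<bar>)) ^ 3"
      using softmax_line_expansion[OF K _ _ f L b, of w ?l "A * (\<Sum>i\<in>I. \<bar>y i\<bar>)"] l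
      by (simp add: W_def[symmetric] u_def[symmetric] e1 e2 w_pos)
    moreover have "(f2 u * (\<Sum>i\<in>I. \<alpha> i * y i)\<^sup>2 + f1 u * (b * ((\<Sum>i\<in>I. \<Sum>j\<in>I. \<gamma> i j * (y i * y j))
        - (\<Sum>i\<in>I. \<alpha> i * y i)\<^sup>2))) / 2 = (\<Sum>i\<in>I. \<Sum>j\<in>I. d i j * (y i * y j))"
      unfolding sq d_def
      by (simp add: sum_distrib_left sum_subtractf[symmetric] sum.distrib[symmetric]
          sum_divide_distrib algebra_simps)
    moreover have "f1 u * (\<Sum>i\<in>I. \<alpha> i * y i) = (\<Sum>i\<in>I. f1 u * \<alpha> i * y i)"
      by (simp add: sum_distrib_left mult_ac)
    ultimately show ?thesis
      by (simp add: power_mult_distrib mult_ac)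
  qed
  then show ?thesis
    by (intro exI[of _ "f u"] exI[of _ "\<lambda>i. f1 u * \<alpha> i"] exI[of _ d]) simp
qed

text \<open>Universality of the maximum of finitely many affine functions of independent steps. Replacing one
  step after the other changes the smooth maximum only by third order terms, as the first and second
  moments agree; this costs \<open>n\<close> times the bound on the cubic error for each of the two measures. The
  last term is the price of the smoothing, paid once for each measure. A large \<open>b\<close> makes the second
  error small and the first one large, hence the choice of \<open>b\<close> is left open.\<close>

theorem lindeberg_max:
  fixes a :: "'k \<Rightarrow> nat \<Rightarrow> 'i \<Rightarrow> real" and g :: "'k \<Rightarrow> real" and f f1 f2 f3 :: "real \<Rightarrow> real"
  assumes I: "finite I" and K: "finite K" "K \<noteq> {}"
    and A: "\<And>k j i. k \<in> K \<Longrightarrow> j < n \<Longrightarrow> i \<in> I \<Longrightarrow> \<bar>a k j i\<bar> \<le> A" "0 \<le> A"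
    and f: "\<And>u. (f has_real_derivative f1 u) (at u)"
      "\<And>u. (f1 has_real_derivative f2 u) (at u)"
      "\<And>u. (f2 has_real_derivative f3 u) (at u)"
    and L: "\<And>u. \<bar>f u\<bar> \<le> L" "\<And>u. \<bar>f1 u\<bar> \<le> L" "\<And>u. \<bar>f2 u\<bar> \<le> L" "\<And>u. \<bar>f3 u\<bar> \<le> L"
    and b: "1 \<le> b"
    and \<mu>: "prob_space \<mu>" "sets \<mu> = sets (\<Pi>\<^sub>M i\<in>I. borel)"
      "integrable \<mu> (\<lambda>y. (\<Sum>i\<in>I. \<bar>y i\<bar>) ^ 3)" "(\<integral>y. (\<Sum>i\<in>I. \<bar>y i\<bar>) ^ 3 \<partial>\<mu>) \<le> \<tau>"
    and \<nu>: "prob_space \<nu>" "sets \<nu> = sets (\<Pi>\<^sub>M i\<in>I. borel)"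
      "integrable \<nu> (\<lambda>y. (\<Sum>i\<in>I. \<bar>y i\<bar>) ^ 3)" "(\<integral>y. (\<Sum>i\<in>I. \<bar>y i\<bar>) ^ 3 \<partial>\<nu>) \<le> \<tau>"
    and mean: "\<And>i. i \<in> I \<Longrightarrow> (\<integral>y. y i \<partial>\<mu>) = (\<integral>y. y i \<partial>\<nu>)"
    and cov: "\<And>i j. i \<in> I \<Longrightarrow> j \<in> I \<Longrightarrow> (\<integral>y. y i * y j \<partial>\<mu>) = (\<integral>y. y i * y j \<partial>\<nu>)"
  defines "V \<equiv> \<lambda>x. Max ((\<lambda>k. g k + (\<Sum>j<n. \<Sum>i\<in>I. a k j i * x j i)) ` K)"
  shows "\<bar>(\<integral>x. f (V x) \<partial>(\<Pi>\<^sub>M j\<in>{..<n}. \<mu>)) - (\<integral>x. f (V x) \<partial>(\<Pi>\<^sub>M j\<in>{..<n}. \<nu>))\<bar>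
    \<le> real n * (6 * L * b\<^sup>2 * A ^ 3 * \<tau>) + 2 * (L * (ln (real (card K)) / b))"
proof -
  define v where "v x k = g k + (\<Sum>j<n. \<Sum>i\<in>I. a k j i * x j i)" for x :: "nat \<Rightarrow> 'i \<Rightarrow> real" and k
  define F where "F x = ln (\<Sum>k\<in>K. exp (b * v x k)) / b" for x
  have V: "V x = Max (v x ` K)" for x
    by (simp add: V_def v_def[abs_def])
  have L0: "0 \<le> L"
    using L(1)[of 0] by linarith
  have f_lip: "\<bar>f s - f t\<bar> \<le> L * \<bar>s - t\<bar>" for s t
    using field_differentiable_bound[OF convex_UNIV, of f f1 L s t] f(1) L(2)
    by (simp add: has_field_derivative_at_within)
  have fm[measurable]: "f \<in> borel_measurable borel"
    using f(1) by (intro borel_measurable_continuous_onI DERIV_continuous_on) auto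
  have FV: "\<bar>f (F x) - f (V x)\<bar> \<le> L * (ln (real (card K)) / b)" for x
  proof -
    have "\<bar>F x - V x\<bar> \<le> ln (real (card K)) / b"
      unfolding F_def V using K b by (intro softmax_bounds) auto
    then show ?thesis
      using f_lip[of "F x" "V x"] L0 by (meson mult_left_mono order_trans)
  qed
  have meas: "(\<lambda>x. f (F x)) \<in> borel_measurable (\<Pi>\<^sub>M j\<in>{..<n}. M)"
    "(\<lambda>x. f (V x)) \<in> borel_measurable (\<Pi>\<^sub>M j\<in>{..<n}. M)"
    if "sets M = sets (\<Pi>\<^sub>M i\<in>I. borel)" for M :: "('i \<Rightarrow> real) measure"
  proof -
    have [measurable]: "(\<lambda>x. x j i) \<in> borel_measurable (\<Pi>\<^sub>M j\<in>{..<n}. M)"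
      if "j < n" "i \<in> I" for j i
    proof -
      have "(\<lambda>y. y i) \<in> borel_measurable M"
        using \<open>i \<in> I\<close> by (subst measurable_cong_sets[OF \<open>sets M = _\<close> refl]) simp
      then show ?thesis
        using \<open>j < n\<close> by (intro measurable_compose[OF measurable_component_singleton[of j]]) auto
    qed
    have [measurable]: "(\<lambda>x. v x k) \<in> borel_measurable (\<Pi>\<^sub>M j\<in>{..<n}. M)" for k
      unfolding v_def by measurable
    show "(\<lambda>x. f (F x)) \<in> borel_measurable (\<Pi>\<^sub>M j\<in>{..<n}. M)"
      unfolding F_def by measurable
    have "(\<lambda>x. Max ((\<lambda>k. v x k) ` K)) \<in> borel_measurable (\<Pi>\<^sub>M j\<in>{..<n}. M)"
      using K by (intro borel_measurable_Max) auto
    then show "(\<lambda>x. f (V x)) \<in> borel_measurable (\<Pi>\<^sub>M j\<in>{..<n}. M)"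
      unfolding V by measurable
  qed
  have "\<bar>(\<integral>x. f (F x) \<partial>(\<Pi>\<^sub>M j\<in>{..<n}. \<mu>)) - (\<integral>x. f (F x) \<partial>(\<Pi>\<^sub>M j\<in>{..<n}. \<nu>))\<bar>
      \<le> real n * (6 * L * b\<^sup>2 * A ^ 3 * \<tau>)"
  proof (rule product_measure_swap[OF \<mu>(1) \<nu>(1) _ meas(1)[OF \<mu>(2)] L(1)])
    show "sets \<nu> = sets \<mu>"
      using \<mu>(2) \<nu>(2) by simp
    fix j and x :: "nat \<Rightarrow> 'i \<Rightarrow> real"
    assume j: "j < n"
    define g' where "g' k = g k + (\<Sum>j'\<in>{..<n}-{j}. \<Sum>i\<in>I. a k j' i * x j' i)" for k
    have v': "v (x(j := y)) k = g' k + (\<Sum>i\<in>I. a k j i * y i)" for y k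
    proof -
      have "(\<Sum>j'<n. \<Sum>i\<in>I. a k j' i * (x(j := y)) j' i)
          = (\<Sum>i\<in>I. a k j i * y i) + (\<Sum>j'\<in>{..<n}-{j}. \<Sum>i\<in>I. a k j' i * (x(j := y)) j' i)"
        using j by (subst sum.remove[of _ j]) auto
      also have "(\<Sum>j'\<in>{..<n}-{j}. \<Sum>i\<in>I. a k j' i * (x(j := y)) j' i)
          = (\<Sum>j'\<in>{..<n}-{j}. \<Sum>i\<in>I. a k j' i * x j' i)"
        by (intro sum.cong) auto
      finally show ?thesis
        by (simp add: v_def g'_def)
    qed
    let ?h = "\<lambda>y. f (F (x(j := y)))"
    have h: "?h y = f (ln (\<Sum>k\<in>K. exp (b * (g' k + (\<Sum>i\<in>I. a k j i * y i)))) / b)" for y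
      by (simp add: F_def v')
    obtain c0 c d where exp: "\<And>y. \<bar>?h y - c0 - (\<Sum>i\<in>I. c i * y i) - (\<Sum>i\<in>I. \<Sum>i'\<in>I. d i i' * (y i * y i'))\<bar>
           \<le> 3 * L * b\<^sup>2 * A ^ 3 * (\<Sum>i\<in>I. \<bar>y i\<bar>) ^ 3"
      using softmax_swap_expansion[OF I K _ f L(2,3,4) b, of "\<lambda>k. a k j" A g'] A(1)[OF _ j]
      unfolding h by auto
    have R: "0 \<le> 3 * L * b\<^sup>2 * A ^ 3"
      using L0 A(2) by simp
    have hint: "integrable M ?h"
      if "sets M = sets (\<Pi>\<^sub>M i\<in>I. borel)" "prob_space M" for M
    proof -
      interpret prob_space M by fact
      have [measurable]: "(\<lambda>y. y i) \<in> borel_measurable M" if "i \<in> I" for i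
        using that by (subst measurable_cong_sets[OF \<open>sets M = _\<close> refl]) simp
      show ?thesis
        unfolding h using L(1) by (intro integrable_const_bound[of _ L]) auto
    qed
    show "\<bar>(\<integral>y. ?h y \<partial>\<mu>) - (\<integral>y. ?h y \<partial>\<nu>)\<bar> \<le> 6 * L * b\<^sup>2 * A ^ 3 * \<tau>"
      using integral_quadratic_expansion[OF I \<mu>(1,2) hint[OF \<mu>(2,1)] \<mu>(3,4) exp R]
        integral_quadratic_expansion[OF I \<nu>(1,2) hint[OF \<nu>(2,1)] \<nu>(3,4) exp R]
      by (simp add: mean cov cong: sum.cong)
  qed
  moreover have "\<bar>(\<integral>x. f (F x) \<partial>(\<Pi>\<^sub>M j\<in>{..<n}. M)) - (\<integral>x. f (V x) \<partial>(\<Pi>\<^sub>M j\<in>{..<n}. M))\<bar>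
      \<le> L * (ln (real (card K)) / b)"
    if M: "sets M = sets (\<Pi>\<^sub>M i\<in>I. borel)" "prob_space M" for M
  proof -
    interpret prob_space "\<Pi>\<^sub>M j\<in>{..<n}. M"
      by (intro prob_space_PiM M)
    have int: "integrable (\<Pi>\<^sub>M j\<in>{..<n}. M) (\<lambda>x. f (F x))" "integrable (\<Pi>\<^sub>M j\<in>{..<n}. M) (\<lambda>x. f (V x))"
      using meas[OF M(1)] L(1) by (intro integrable_const_bound[of _ L] | simp)+
    have "\<bar>(\<integral>x. f (F x) - f (V x) \<partial>(\<Pi>\<^sub>M j\<in>{..<n}. M))\<bar> \<le> (\<integral>x. \<bar>f (F x) - f (V x)\<bar> \<partial>(\<Pi>\<^sub>M j\<in>{..<n}. M))"
      by (rule integral_abs_bound)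
    also have "\<dots> \<le> (\<integral>x. L * (ln (real (card K)) / b) \<partial>(\<Pi>\<^sub>M j\<in>{..<n}. M))"
      using int FV by (intro integral_mono integrable_abs Bochner_Integration.integrable_diff) auto
    finally show ?thesis
      using int by (simp add: prob_space)
  qed
  from this[OF \<mu>(2,1)] this[OF \<nu>(2,1)] calculation show ?thesis
    by linarith
qed

section \<open>Nondecreasing subsequences as maxima over cuts\<close>

lemma sum_increments: "(\<Sum>i=1..r. t i - t (i - 1)) = t r - t (0::nat)" for t :: "nat \<Rightarrow> real"
  by (induction r) auto

text \<open>A nondecreasing colouring of \<open>{1..n}\<close> with the colours \<open>1, \<dots>, m\<close>, encoded by its jumps: the block
  \<open>{k (r - 1)<..k r}\<close> has colour \<open>r\<close>. These are the discrete versions of the time points over which the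
  limit is maximised. Restricting \<open>k\<close> to \<open>{0..m}\<close> makes the set finite.\<close>

definition cuts :: "nat \<Rightarrow> nat \<Rightarrow> (nat \<Rightarrow> nat) set" where
  "cuts m n = {k \<in> {0..m} \<rightarrow>\<^sub>E {0..n}. k 0 = 0 \<and> k m = n \<and> (\<forall>r\<in>{1..m}. k (r - 1) \<le> k r)}"

lemma cuts_mono:
  assumes "k \<in> cuts m n" "r \<le> s" "s \<le> m"
  shows "k r \<le> k s"
  using assms(2,3)
proof (induction s rule: dec_induct)
  case (step s)
  then show ?case
    using assms(1) by (force simp: cuts_def)
qed simp

lemma finite_cuts: "finite (cuts m n)"
  by (rule finite_subset[of _ "{0..m} \<rightarrow>\<^sub>E {0..n}"]) (auto simp: cuts_def intro: finite_PiE)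

text \<open>Only the polynomial growth in \<open>n\<close> matters, because the smoothing error involves the logarithm of the
  number of competitors.\<close>

lemma card_cuts_le: "card (cuts m n) \<le> (n + 1) ^ (m + 1)"
proof -
  have "card (cuts m n) \<le> card ({0..m} \<rightarrow>\<^sub>E {0..n})"
    by (rule card_mono) (auto simp: cuts_def intro: finite_PiE)
  also have "\<dots> = (n + 1) ^ (m + 1)"
    by (simp add: card_PiE)
  finally show ?thesis .
qed

lemma cuts_nonempty: "1 \<le> m \<Longrightarrow> cuts m n \<noteq> {}"
proof -
  assume "1 \<le> m"
  then have "(\<lambda>r\<in>{0..m}. if r = m then n else 0) \<in> cuts m n"
    by (auto simp: cuts_def)
  then show ?thesis by auto
qed

text \<open>An increasing enumeration of the chosen positions is the same as the set of these positions.\<close>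

lemma LI_eq_card:
  "LI x n = Max (card ` {S. S \<subseteq> {1..n} \<and> mono_on S x})"
proof -
  have "{l. \<exists>i::nat \<Rightarrow> nat. strict_mono_on {1..l} i \<and> i ` {1..l} \<subseteq> {1..n} \<and> mono_on {1..l} (\<lambda>j. x (i j))}
    = card ` {S. S \<subseteq> {1..n} \<and> mono_on S x}" (is "?A = ?B")
  proof (intro subset_antisym subsetI)
    fix l assume "l \<in> ?A"
    then obtain i :: "nat \<Rightarrow> nat" where i: "strict_mono_on {1..l} i" "i ` {1..l} \<subseteq> {1..n}"
      "mono_on {1..l} (\<lambda>j. x (i j))"
      by blast
    have "mono_on (i ` {1..l}) x"
    proof (rule mono_onI)
      fix u v assume "u \<in> i ` {1..l}" "v \<in> i ` {1..l}" "u \<le> v"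
      then obtain j j' where j: "j \<in> {1..l}" "j' \<in> {1..l}" "u = i j" "v = i j'"
        by blast
      then have "j \<le> j'"
        using i(1) \<open>u \<le> v\<close> by (meson linorder_not_le strict_mono_onD)
      then show "x u \<le> x v"
        using mono_onD[OF i(3) j(1,2)] j by simp
    qed
    moreover have "card (i ` {1..l}) = l"
      using strict_mono_on_imp_inj_on[OF i(1)] by (simp add: card_image)
    ultimately show "l \<in> ?B"
      using i(2) by (metis (mono_tags, lifting) imageI mem_Collect_eq)
  next
    fix l assume "l \<in> ?B"
    then obtain S where S: "S \<subseteq> {1..n}" "mono_on S x" "l = card S"
      by blast
    have fin: "finite S"
      using S(1) by (rule finite_subset) simp
    define i where "i j = sorted_list_of_set S ! (j - 1)" for j
    have len: "length (sorted_list_of_set S) = l"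
      using S(3) by simp
    have "strict_mono_on {1..l} i"
      using sorted_wrt_nth_less[OF strict_sorted_list_of_set[of S]] len
      by (auto simp: strict_mono_on_def i_def)
    moreover have iS: "i j \<in> S" if "j \<in> {1..l}" for j
      using that nth_mem[of "j - 1" "sorted_list_of_set S"] fin len by (auto simp: i_def)
    moreover have "mono_on {1..l} (\<lambda>j. x (i j))"
    proof (rule mono_onI)
      fix j j' assume j: "j \<in> {1..l}" "j' \<in> {1..l}" "j \<le> j'"
      then have "i j \<le> i j'"
        using \<open>strict_mono_on {1..l} i\<close> by (metis order_le_less strict_mono_onD)
      then show "x (i j) \<le> x (i j')"
        using mono_onD[OF S(2) iS[OF j(1)] iS[OF j(2)]] by simp
    qed
    ultimately show "l \<in> ?A"
      using S(1) by blast
  qed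
  then show ?thesis
    by (simp add: LI_def)
qed

text \<open>A nondecreasing subsequence first uses \<open>\<alpha> 1\<close>, then \<open>\<alpha> 2\<close>, and so on. Cutting \<open>{1..n}\<close> after the last
  use of each letter, it is contained in the set \<open>N k\<close> of all positions which carry the letter of their block;
  conversely every \<open>N k\<close> is itself a nondecreasing subsequence.\<close>

lemma LI_eq_Max_cuts:
  fixes x :: "nat \<Rightarrow> 'c::linorder"
  assumes m: "1 \<le> m" and \<alpha>: "strict_mono_on {1..m} \<alpha>" and x: "\<And>j. j \<in> {1..n} \<Longrightarrow> x j \<in> \<alpha> ` {1..m}"
  shows "LI x n = Max ((\<lambda>k. \<Sum>r=1..m. card {j \<in> {k (r - 1)<..k r}. x j = \<alpha> r}) ` cuts m n)"
proof -
  define N where "N k = (\<Union>r\<in>{1..m}. {j \<in> {k (r - 1)<..k r}. x j = \<alpha> r})" for k :: "nat \<Rightarrow> nat"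
  have \<alpha>_le: "\<alpha> r \<le> \<alpha> s \<longleftrightarrow> r \<le> s" if "r \<in> {1..m}" "s \<in> {1..m}" for r s
    using \<alpha> that by (metis linorder_not_le order_le_less strict_mono_onD)
  have block: "r \<le> s" if "k \<in> cuts m n" "r \<in> {1..m}" "s \<in> {1..m}"
    "i \<in> {k (r - 1)<..k r}" "j \<in> {k (s - 1)<..k s}" "i \<le> j" for k r s and i j :: nat
  proof (rule ccontr)
    assume "\<not> r \<le> s"
    then have "k s \<le> k (r - 1)"
      using that by (intro cuts_mono[of k m n]) auto
    then show False
      using that by auto
  qed
  have cardN: "card (N k) = (\<Sum>r=1..m. card {j \<in> {k (r - 1)<..k r}. x j = \<alpha> r})" if "k \<in> cuts m n" for k
    unfolding N_def
  proof (rule card_UN_disjoint)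
    have "r = s" if "r \<in> {1..m}" "s \<in> {1..m}" "\<alpha> r = \<alpha> s" for r s
      using strict_mono_on_imp_inj_on[OF \<alpha>] that by (auto dest: inj_onD)
    then show "\<forall>r\<in>{1..m}. \<forall>s\<in>{1..m}. r \<noteq> s \<longrightarrow>
        {j \<in> {k (r - 1)<..k r}. x j = \<alpha> r} \<inter> {j \<in> {k (s - 1)<..k s}. x j = \<alpha> s} = {}"
      by fastforce
  qed auto
  have N: "N k \<subseteq> {1..n}" "mono_on (N k) x" if k: "k \<in> cuts m n" for k
  proof -
    show "N k \<subseteq> {1..n}"
    proof
      fix j assume "j \<in> N k"
      then obtain r where r: "r \<in> {1..m}" "j \<in> {k (r - 1)<..k r}"
        by (auto simp: N_def)
      have "k r \<le> k m" "k m = n"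
        using k r by (auto intro: cuts_mono simp: cuts_def)
      then show "j \<in> {1..n}"
        using r by auto
    qed
    show "mono_on (N k) x"
    proof (rule mono_onI)
      fix i j assume "i \<in> N k" "j \<in> N k" "i \<le> j"
      then obtain r s where rs: "r \<in> {1..m}" "s \<in> {1..m}" "i \<in> {k (r - 1)<..k r}" "j \<in> {k (s - 1)<..k s}"
        and x: "x i = \<alpha> r" "x j = \<alpha> s"
        unfolding N_def by blast
      show "x i \<le> x j"
        using block[OF k rs \<open>i \<le> j\<close>] \<alpha>_le[OF rs(1,2)] x by simp
    qed
  qed
  have ex: "\<exists>k\<in>cuts m n. S \<subseteq> N k" if S: "S \<subseteq> {1..n}" "mono_on S x" for S
  proof -
    have finS: "finite S"
      using S(1) by (rule finite_subset) simp
    \<comment> \<open>The last cut is forced to be \<open>n\<close>, which may exceed the last used position; unused letters repeat the preceding cut.\<close>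
    define k where "k = (\<lambda>r\<in>{0..m}. if r = 0 then 0 else if r = m then n else Max (insert 0 {j \<in> S. x j \<le> \<alpha> r}))"
    have ub: "Max (insert 0 {j \<in> S. x j \<le> \<alpha> r}) \<le> n" for r
      using S(1) finS by (subst Max_le_iff) auto
    have mono: "Max (insert 0 {j \<in> S. x j \<le> \<alpha> r}) \<le> Max (insert 0 {j \<in> S. x j \<le> \<alpha> s})"
      if "\<alpha> r \<le> \<alpha> s" for r s
      using finS that by (intro Max_mono) auto
    have k: "k \<in> cuts m n"
    proof -
      have "k (r - 1) \<le> k r" if r: "r \<in> {1..m}" for r
      proof (cases "r - 1 = 0 \<or> r = m")
        case True
        then show ?thesis
          using ub r by (auto simp: k_def)
      next
        case False
        then have "\<alpha> (r - 1) \<le> \<alpha> r"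
          using r by (subst \<alpha>_le) auto
        then show ?thesis
          using False r mono by (auto simp: k_def)
      qed
      then show ?thesis
        using m ub by (auto simp: cuts_def k_def)
    qed
    moreover have "S \<subseteq> N k"
    proof
      fix j assume j: "j \<in> S"
      then obtain r where r: "r \<in> {1..m}" "x j = \<alpha> r"
        using x S(1) by blast
      have "j \<le> k r"
        using j r finS S(1) by (auto simp: k_def intro!: Max_ge)
      moreover have "k (r - 1) < j"
      proof (cases "r = 1")
        case True
        then show ?thesis
          using j S(1) m by (auto simp: k_def)
      next
        case False
        have "i < j" if i: "i \<in> S" "x i \<le> \<alpha> (r - 1)" for i
        proof (rule ccontr)
          assume "\<not> i < j"
          then have "x j \<le> x i"
            using mono_onD[OF S(2) j i(1)] by simp
          then have "\<alpha> r \<le> \<alpha> (r - 1)"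
            using i r by simp
          then show False
            using False r by (subst (asm) \<alpha>_le) auto
        qed
        moreover have "0 < j"
          using j S(1) by auto
        ultimately have "Max (insert 0 {i \<in> S. x i \<le> \<alpha> (r - 1)}) < j"
          using finS by (subst Max_less_iff) auto
        then show ?thesis
          using False r by (auto simp: k_def)
      qed
      ultimately show "j \<in> N k"
        using r by (auto simp: N_def)
    qed
    ultimately show ?thesis
      by blast
  qed
  let ?S = "{S. S \<subseteq> {1..n} \<and> mono_on S x}"
  have fin: "finite ?S"
    by (rule finite_subset[of _ "Pow {1..n}"]) auto
  have "Max (card ` ?S) = Max ((\<lambda>k. card (N k)) ` cuts m n)"
  proof (rule antisym)
    show "Max (card ` ?S) \<le> Max ((\<lambda>k. card (N k)) ` cuts m n)"
    proof (rule Max.boundedI)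
      fix c assume "c \<in> card ` ?S"
      then obtain S where S: "S \<subseteq> {1..n}" "mono_on S x" "c = card S"
        by auto
      obtain k where k: "k \<in> cuts m n" "S \<subseteq> N k"
        using ex[OF S(1,2)] by blast
      have "c \<le> card (N k)"
        unfolding S(3) using k N(1)[OF k(1)] by (intro card_mono) (auto intro: finite_subset)
      also have "\<dots> \<le> Max ((\<lambda>k. card (N k)) ` cuts m n)"
        using k by (intro Max_ge) (auto simp: finite_cuts)
      finally show "c \<le> Max ((\<lambda>k. card (N k)) ` cuts m n)" .
    qed (use fin in \<open>auto intro!: exI[of _ "{}"] simp: mono_on_def\<close>)
    show "Max ((\<lambda>k. card (N k)) ` cuts m n) \<le> Max (card ` ?S)"
      using fin N cuts_nonempty[OF m] by (intro Max_mono) (auto simp: finite_cuts)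
  qed
  also have "(\<lambda>k. card (N k)) ` cuts m n
      = (\<lambda>k. \<Sum>r=1..m. card {j \<in> {k (r - 1)<..k r}. x j = \<alpha> r}) ` cuts m n"
    using cardN by (intro image_cong) auto
  finally show ?thesis
    by (simp add: LI_eq_card)
qed

section \<open>Maxima over a grid for continuous paths\<close>

text \<open>For a fixed continuous path the penalised maximum over the grid converges to the maximum over the
  constrained time points.

  From below, a constrained time vector is rounded down to the grid. Rounding preserves equalities
  \<open>t i = t (i - 1)\<close>, so that there is no penalty, and by uniform continuity little is lost.

  From above, let \<open>D\<close> be the total length of the penalised blocks of a grid vector \<open>t\<close>. Collapsing these blocks
  and giving their length to the free block \<open>r0\<close> yields an admissible \<open>t'\<close> with all entries within \<open>D\<close> of those
  of \<open>t\<close>. If \<open>D\<close> is small, the values at \<open>t\<close> and \<open>t'\<close> are close; otherwise the penalty, of order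
  \<open>sqrt n * D\<close>, outweighs \<open>2 * C\<close>, a bound on the oscillation of the whole functional.\<close>

lemma penalised_grid_max_tendsto:
  fixes b :: "nat \<Rightarrow> real \<Rightarrow> real" and q :: "nat \<Rightarrow> real" and m :: nat and J :: "nat set"
  assumes cont: "\<And>i. i \<in> {1..m-1} \<Longrightarrow> continuous_on {0..1} (b i)"
    and J: "J \<subseteq> {1..m}" "\<And>r. r \<in> J \<Longrightarrow> 0 < q r" "\<And>r. r \<in> {1..m} - J \<Longrightarrow> q r = 0"
    and r0: "r0 \<in> {1..m}" "r0 \<notin> J"
  defines "T \<equiv> {t. t 0 = 0 \<and> t m = 1 \<and> (\<forall>i\<in>{1..m}. t (i - 1) \<le> t i) \<and> (\<forall>i\<in>J. t i = t (i - 1))}"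
  shows "(\<lambda>n. Max ((\<lambda>k. (\<Sum>i=1..m-1. b i (real (k i) / real n))
            - (\<Sum>r=1..m. q r * (real (k r) - real (k (r - 1)))) / sqrt (real n)) ` cuts m n))
         \<longlonglongrightarrow> (SUP t\<in>T. \<Sum>i=1..m-1. b i (t i))"
proof -
  define \<Phi> where "\<Phi> t = (\<Sum>i=1..m-1. b i (t i))" for t :: "nat \<Rightarrow> real"
  define val where "val n k = \<Phi> (\<lambda>i. real (k i) / real n)
      - (\<Sum>r=1..m. q r * (real (k r) - real (k (r - 1)))) / sqrt (real n)" for n and k :: "nat \<Rightarrow> nat"
  define S where "S = (SUP t\<in>T. \<Phi> t)"
  have m: "1 \<le> m"
    using r0 by auto
  have q0: "0 \<le> q r" if "r \<in> {1..m}" for r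
    using J that by (metis DiffI order_le_less)
  have unif: "\<exists>\<delta>>0. \<forall>s t. (\<forall>i\<in>{1..m-1}. s i \<in> {0..1} \<and> t i \<in> {0..1} \<and> \<bar>s i - t i\<bar> \<le> \<delta>) \<longrightarrow> \<Phi> s \<le> \<Phi> t + \<epsilon>"
    if \<epsilon>: "0 < \<epsilon>" for \<epsilon>
  proof -
    have "\<forall>i\<in>{1..m-1}. \<exists>d>0. \<forall>s\<in>{0..1}. \<forall>t\<in>{0..1}. \<bar>s - t\<bar> < d \<longrightarrow> \<bar>b i s - b i t\<bar> < \<epsilon> / real m"
    proof
      fix i assume "i \<in> {1..m-1}"
      then have "uniformly_continuous_on {0..1} (b i)"
        using cont by (intro compact_uniformly_continuous) auto
      moreover have "0 < \<epsilon> / real m"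
        using \<epsilon> m by simp
      ultimately obtain d where "d > 0" "\<And>s t. s \<in> {0..1} \<Longrightarrow> t \<in> {0..1} \<Longrightarrow> dist t s < d \<Longrightarrow> dist (b i t) (b i s) < \<epsilon> / real m"
        unfolding uniformly_continuous_on_def by metis
      then show "\<exists>d>0. \<forall>s\<in>{0..1}. \<forall>t\<in>{0..1}. \<bar>s - t\<bar> < d \<longrightarrow> \<bar>b i s - b i t\<bar> < \<epsilon> / real m"
        unfolding dist_real_def by blast
    qed
    then obtain d where d: "\<And>i. i \<in> {1..m-1} \<Longrightarrow> 0 < d i"
      "\<And>i s t. i \<in> {1..m-1} \<Longrightarrow> s \<in> {0..1} \<Longrightarrow> t \<in> {0..1} \<Longrightarrow> \<bar>s - t\<bar> < d i \<Longrightarrow> \<bar>b i s - b i t\<bar> < \<epsilon> / real m"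
      by (metis (no_types, lifting))
    define \<delta> where "\<delta> = Min (insert 1 (d ` {1..m-1})) / 2"
    have "0 < Min (insert 1 (d ` {1..m-1}))"
      using d(1) by (subst Min_gr_iff) auto
    then have \<delta>: "0 < \<delta>" "2 * \<delta> = Min (insert 1 (d ` {1..m-1}))"
      by (auto simp: \<delta>_def)
    have \<delta>d: "\<delta> < d i" if "i \<in> {1..m-1}" for i
    proof -
      have "2 * \<delta> \<le> d i"
        unfolding \<delta>(2) using that by (intro Min_le) auto
      then show ?thesis
        using \<delta>(1) by linarith
    qed
    have "\<Phi> s \<le> \<Phi> t + \<epsilon>"
      if st: "\<forall>i\<in>{1..m-1}. s i \<in> {0..1} \<and> t i \<in> {0..1} \<and> \<bar>s i - t i\<bar> \<le> \<delta>" for s t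
    proof -
      have "\<Phi> s - \<Phi> t = (\<Sum>i=1..m-1. b i (s i) - b i (t i))"
        by (simp add: \<Phi>_def sum_subtractf)
      also have "\<dots> \<le> (\<Sum>i=1..m-1. \<epsilon> / real m)"
      proof (rule sum_mono)
        fix i assume i: "i \<in> {1..m-1}"
        have "\<bar>b i (s i) - b i (t i)\<bar> < \<epsilon> / real m"
          using st \<delta>d[OF i] i by (intro d(2)[OF i]) fastforce+
        then show "b i (s i) - b i (t i) \<le> \<epsilon> / real m"
          by linarith
      qed
      also have "\<dots> = real (m - 1) * (\<epsilon> / real m)"
        by simp
      also have "\<dots> \<le> real m * (\<epsilon> / real m)"
        using \<epsilon> by (intro mult_right_mono) auto
      also have "\<dots> = \<epsilon>"
        using m by simp
      finally show ?thesis
        by simp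
    qed
    with \<delta>(1) show ?thesis
      by blast
  qed
  have "\<exists>C. \<forall>t. (\<forall>i\<in>{1..m-1}. t i \<in> {0..1}) \<longrightarrow> \<bar>\<Phi> t\<bar> \<le> C"
  proof -
    have "\<forall>i\<in>{1..m-1}. \<exists>c. \<forall>t\<in>{0..1}. \<bar>b i t\<bar> \<le> c"
    proof
      fix i assume "i \<in> {1..m-1}"
      then have "bounded (b i ` {0..1})"
        using cont by (intro compact_imp_bounded compact_continuous_image) auto
      then show "\<exists>c. \<forall>t\<in>{0..1}. \<bar>b i t\<bar> \<le> c"
        by (auto simp: bounded_iff)
    qed
    then obtain c where c: "\<And>i t. i \<in> {1..m-1} \<Longrightarrow> t \<in> {0..1} \<Longrightarrow> \<bar>b i t\<bar> \<le> c i"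
      by metis
    have "\<bar>\<Phi> t\<bar> \<le> (\<Sum>i=1..m-1. c i)" if "\<forall>i\<in>{1..m-1}. t i \<in> {0..1}" for t
      unfolding \<Phi>_def using that c by (intro order_trans[OF sum_abs] sum_mono) auto
    then show ?thesis
      by blast
  qed
  then obtain C where C: "\<And>t. (\<And>i. i \<in> {1..m-1} \<Longrightarrow> t i \<in> {0..1}) \<Longrightarrow> \<bar>\<Phi> t\<bar> \<le> C"
    by blast
  have T_mono: "t r \<le> t s" if "t \<in> T" "r \<le> s" "s \<le> m" for t r s
    using that(2,3)
  proof (induction s rule: dec_induct)
    case (step s)
    have "\<forall>i\<in>{1..m}. t (i - 1) \<le> t i"
      using that(1) by (simp add: T_def)
    from bspec[OF this, of "Suc s"] have "t s \<le> t (Suc s)"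
      using step by simp
    then show ?case
      using step by simp
  qed simp
  have T01: "t i \<in> {0..1}" if "t \<in> T" "i \<le> m" for t i
    using T_mono[OF that(1), of 0 i] T_mono[OF that(1), of i m] that by (auto simp: T_def)
  have T_ne: "T \<noteq> {}"
  proof -
    have "r0 \<le> i \<longleftrightarrow> r0 \<le> i - 1" if "i \<in> J" for i
      using that r0 by (cases "i = r0") auto
    then have "(\<lambda>r. if r0 \<le> r then 1 else 0) \<in> T"
      using r0 by (auto simp: T_def)
    then show ?thesis by auto
  qed
  have TC: "\<bar>\<Phi> t\<bar> \<le> C" if "t \<in> T" for t
    using T01[OF that] by (intro C) auto
  have bdd: "bdd_above (\<Phi> ` T)"
    using TC by (intro bdd_aboveI[of _ C]) force
  have S_upper: "\<Phi> t \<le> S" if "t \<in> T" for t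
    unfolding S_def using that bdd by (intro cSUP_upper)
  \<comment> \<open>The smallest penalty rate; inserting \<open>1\<close> covers the case that no block is penalised.\<close>
  define q' where "q' = Min (insert 1 (q ` J))"
  have finJ: "finite J"
    using J(1) by (rule finite_subset) simp
  have q': "0 < q'" "\<And>r. r \<in> J \<Longrightarrow> q' \<le> q r"
    using finJ J(2) by (auto simp: q'_def)
  have main: "\<forall>\<^sub>F n in sequentially. \<bar>Max (val n ` cuts m n) - S\<bar> \<le> \<epsilon>" if \<epsilon>: "0 < \<epsilon>" for \<epsilon>
  proof -
    obtain \<delta> where \<delta>: "0 < \<delta>" "\<And>s t. (\<And>i. i \<in> {1..m-1} \<Longrightarrow> s i \<in> {0..1} \<and> t i \<in> {0..1} \<and> \<bar>s i - t i\<bar> \<le> \<delta>) \<Longrightarrow> \<Phi> s \<le> \<Phi> t + \<epsilon>"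
      using unif[OF \<epsilon>] by (metis (no_types, lifting))
    have "(\<lambda>n. 1 / real n) \<longlonglongrightarrow> 0"
      by (rule lim_1_over_n)
    then have ev1: "\<forall>\<^sub>F n in sequentially. 1 / real n < \<delta>"
      using \<delta>(1) by (rule order_tendstoD)
    have "filterlim (\<lambda>n. sqrt (real n)) at_top sequentially"
      by (intro filterlim_compose[OF sqrt_at_top] filterlim_real_sequentially)
    then have ev2: "\<forall>\<^sub>F n in sequentially. 2 * C / (q' * \<delta>) \<le> sqrt (real n)"
      by (simp add: filterlim_at_top)
    show ?thesis
      using ev1 ev2 eventually_gt_at_top[of 0]
    proof eventually_elim
      case (elim n)
      have n: "0 < real n" "0 < sqrt (real n)"
        using elim by auto
      have "2 * C / (q' * \<delta>) * (q' * \<delta>) \<le> sqrt (real n) * (q' * \<delta>)"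
        using elim(2) q'(1) \<delta>(1) by (intro mult_right_mono) auto
      then have big: "2 * C \<le> sqrt (real n) * (q' * \<delta>)"
        using q'(1) \<delta>(1) by simp
      have upper: "val n k \<le> S + \<epsilon>" if k: "k \<in> cuts m n" for k
      proof -
        define t where "t i = real (k i) / real n" for i
        define \<Delta> where "\<Delta> i = t i - t (i - 1)" for i
        define D where "D = (\<Sum>r\<in>J. \<Delta> r)"
        define t' where "t' r = (\<Sum>i=1..r. if i \<in> J then 0 else \<Delta> i) + (if r0 \<le> r then D else 0)" for r
        have kmn: "k 0 = 0" "k m = n"
          using k by (auto simp: cuts_def)
        have t01: "t i \<in> {0..1}" if "i \<le> m" for i
          using cuts_mono[OF k that order_refl] n kmn by (auto simp: t_def)
        have \<Delta>0: "0 \<le> \<Delta> i" if "i \<in> {1..m}" for i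
          using cuts_mono[OF k, of "i - 1" i] that n by (auto simp: \<Delta>_def t_def divide_right_mono)
        have D0: "0 \<le> D"
          unfolding D_def using J(1) \<Delta>0 by (intro sum_nonneg) auto
        have split: "(\<Sum>i=1..r. \<Delta> i) = (\<Sum>i=1..r. if i \<in> J then 0 else \<Delta> i) + (\<Sum>i\<in>{1..r} \<inter> J. \<Delta> i)" for r
          by (simp add: sum.inter_restrict sum.distrib[symmetric] if_distrib cong: if_cong)
        have tr: "t r = (\<Sum>i\<in>{1..r}. \<Delta> i)" for r
          using sum_increments[of t r] kmn by (simp add: \<Delta>_def t_def)
        have step: "t' i - t' (i - 1) = (if i \<in> J then 0 else \<Delta> i) + (if i = r0 then D else 0)"
          if i: "i \<in> {1..m}" for i
        proof -
          obtain i' where "i = Suc i'"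
            using i by (cases i) auto
          then show ?thesis
            by (auto simp: t'_def)
        qed
        have t'T: "t' \<in> T"
        proof -
          have "t' 0 = 0"
            using r0 by (auto simp: t'_def)
          moreover have "t' m = 1"
            using tr[of m] split[of m] J(1) r0 n kmn
            by (simp add: t'_def D_def t_def Int_absorb1)
          moreover have "t' (i - 1) \<le> t' i" if "i \<in> {1..m}" for i
            using step[OF that] \<Delta>0[OF that] D0 by (auto split: if_splits)
          moreover have "t' i = t' (i - 1)" if "i \<in> J" for i
            using step[of i] that J(1) r0 by (auto split: if_splits)
          ultimately show ?thesis
            by (auto simp: T_def)
        qed
        have dist: "\<bar>t r - t' r\<bar> \<le> D" if "r \<le> m" for r
        proof -
          have "(\<Sum>i\<in>{1..r} \<inter> J. \<Delta> i) \<le> D"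
            unfolding D_def using finJ J(1) \<Delta>0 by (intro sum_mono2) auto
          moreover have "0 \<le> (\<Sum>i\<in>{1..r} \<inter> J. \<Delta> i)"
            using J(1) \<Delta>0 by (intro sum_nonneg) auto
          ultimately show ?thesis
            using D0 unfolding tr split by (auto simp: t'_def)
        qed
        define pen where "pen = (\<Sum>r=1..m. q r * (real (k r) - real (k (r - 1)))) / sqrt (real n)"
        have "pen = sqrt (real n) * (\<Sum>r=1..m. q r * \<Delta> r)"
        proof -
          have "(\<Sum>r=1..m. q r * (real (k r) - real (k (r - 1)))) = real n * (\<Sum>r=1..m. q r * \<Delta> r)"
            unfolding sum_distrib_left \<Delta>_def t_def using n by (intro sum.cong) (auto simp: field_simps)
          then show ?thesis
            unfolding pen_def by (simp add: real_div_sqrt mult.commute[of "real n"] times_divide_eq_right[symmetric] del: times_divide_eq_right)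
        qed
        also have "(\<Sum>r=1..m. q r * \<Delta> r) = (\<Sum>r\<in>J. q r * \<Delta> r)"
          using J(1,3) by (intro sum.mono_neutral_right) auto
        finally have pen: "pen = sqrt (real n) * (\<Sum>r\<in>J. q r * \<Delta> r)" .
        have "q' * D \<le> (\<Sum>r\<in>J. q r * \<Delta> r)"
          unfolding D_def sum_distrib_left using q'(2) \<Delta>0 J(1) by (intro sum_mono mult_right_mono) auto
        then have pen_ge: "sqrt (real n) * (q' * D) \<le> pen"
          unfolding pen using n by (intro mult_left_mono) auto
        have val: "val n k = \<Phi> t - pen"
          by (simp add: val_def pen_def t_def[abs_def])
        show ?thesis
        proof (cases "D \<le> \<delta>")
          case True
          have "\<Phi> t \<le> \<Phi> t' + \<epsilon>"
          proof (rule \<delta>(2))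
            fix i assume "i \<in> {1..m-1}"
            then have "i \<le> m"
              by auto
            then show "t i \<in> {0..1} \<and> t' i \<in> {0..1} \<and> \<bar>t i - t' i\<bar> \<le> \<delta>"
              using t01 T01[OF t'T] dist True by (meson order_trans)
          qed
          moreover have "0 \<le> pen"
            using pen_ge q'(1) D0 n by (meson mult_nonneg_nonneg less_imp_le order_trans)
          ultimately show ?thesis
            using S_upper[OF t'T] val by linarith
        next
          case False
          have "sqrt (real n) * (q' * \<delta>) \<le> sqrt (real n) * (q' * D)"
            using False q'(1) n by (intro mult_left_mono) auto
          then have "2 * C \<le> pen"
            using big pen_ge by linarith
          moreover have "\<bar>\<Phi> t\<bar> \<le> C"
            using t01 by (intro C) auto
          moreover have "- C \<le> \<Phi> t'"
            using TC[OF t'T] by linarith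
          ultimately show ?thesis
            using S_upper[OF t'T] val \<epsilon> by linarith
        qed
      qed
      have lower: "\<Phi> t \<le> Max (val n ` cuts m n) + \<epsilon>" if t: "t \<in> T" for t
      proof -
        define k where "k = (\<lambda>i\<in>{0..m}. nat \<lfloor>real n * t i\<rfloor>)"
        have nt: "0 \<le> real n * t i" "real n * t i \<le> real n" if "i \<le> m" for i
          using T01[OF t that] n by (auto simp: mult_le_cancel_left1)
        have k: "k \<in> cuts m n"
        proof -
          have "k i \<le> n" if "i \<le> m" for i
            using nt[OF that] that by (simp add: k_def nat_le_iff floor_le_iff)
          moreover have "k 0 = 0" "k m = n"
            using t by (auto simp: k_def T_def)
          moreover have "k (i - 1) \<le> k i" if "i \<in> {1..m}" for i
            using T_mono[OF t, of "i - 1" i] that n by (auto simp: k_def intro!: nat_mono floor_mono mult_left_mono)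
          ultimately show ?thesis
            by (auto simp: cuts_def k_def)
        qed
        have k_real: "real (k i) = of_int \<lfloor>real n * t i\<rfloor>" if "i \<le> m" for i
          using nt(1)[OF that] that by (simp add: k_def)
        have near: "\<bar>t i - real (k i) / real n\<bar> \<le> \<delta>" if "i \<le> m" for i
        proof -
          have "\<bar>real n * t i - real (k i)\<bar> \<le> 1"
            unfolding k_real[OF that] by linarith
          then have "\<bar>real n * t i - real (k i)\<bar> / real n \<le> 1 / real n"
            using n by (intro divide_right_mono) auto
          moreover have "\<bar>real n * t i - real (k i)\<bar> / real n = \<bar>t i - real (k i) / real n\<bar>"
          proof -
            have "t i - real (k i) / real n = (real n * t i - real (k i)) / real n"
              using n by (simp add: diff_divide_distrib)
            then show ?thesis
              by simp
          qed
          ultimately show ?thesis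
            using elim(1) by linarith
        qed
        have "q r * (real (k r) - real (k (r - 1))) = 0" if r: "r \<in> {1..m}" for r
        proof (cases "r \<in> J")
          case True
          then have "t r = t (r - 1)"
            using t by (auto simp: T_def)
          moreover have "r - 1 \<le> m"
            using r by auto
          ultimately show ?thesis
            using r by (simp add: k_def)
        qed (use J(3) r in auto)
        then have "(\<Sum>r=1..m. q r * (real (k r) - real (k (r - 1)))) = 0"
          by (intro sum.neutral) blast
        then have val: "val n k = \<Phi> (\<lambda>i. real (k i) / real n)"
          by (simp add: val_def)
        have "\<Phi> t \<le> \<Phi> (\<lambda>i. real (k i) / real n) + \<epsilon>"
        proof (rule \<delta>(2))
          fix i assume "i \<in> {1..m-1}"
          then have i: "i \<le> m"
            by auto
          have "k i \<le> n"
            using k i by (auto simp: cuts_def)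
          then show "t i \<in> {0..1} \<and> real (k i) / real n \<in> {0..1} \<and> \<bar>t i - real (k i) / real n\<bar> \<le> \<delta>"
            using near[OF i] T01[OF t i] n by simp
        qed
        moreover have "val n k \<le> Max (val n ` cuts m n)"
          using k by (intro Max_ge) (auto simp: finite_cuts)
        ultimately show ?thesis
          using val by linarith
      qed
      have "Max (val n ` cuts m n) \<le> S + \<epsilon>"
        using upper cuts_nonempty[OF m] by (subst Max_le_iff) (auto simp: finite_cuts)
      moreover have "S \<le> Max (val n ` cuts m n) + \<epsilon>"
        unfolding S_def using T_ne lower by (intro cSUP_least) auto
      ultimately show ?case
        by linarith
    qed
  qed
  have "(\<lambda>n. Max (val n ` cuts m n)) \<longlonglongrightarrow> S"
  proof (rule tendstoI)
    fix \<epsilon> :: real assume "0 < \<epsilon>"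
    then have "\<forall>\<^sub>F n in sequentially. \<bar>Max (val n ` cuts m n) - S\<bar> \<le> \<epsilon> / 2"
      by (intro main) auto
    then show "\<forall>\<^sub>F n in sequentially. dist (Max (val n ` cuts m n)) S < \<epsilon>"
      by eventually_elim (use \<open>0 < \<epsilon>\<close> in \<open>simp add: dist_real_def\<close>)
  qed
  then show ?thesis
    by (simp add: val_def[abs_def] \<Phi>_def S_def)
qed

section \<open>Increments of Brownian motion\<close>

text \<open>The constant is not optimal; it comes from bounding every summand by the largest one.\<close>

lemma cube_sum_le:
  fixes a :: "'i \<Rightarrow> real"
  assumes I: "finite I" and a: "\<And>i. i \<in> I \<Longrightarrow> 0 \<le> a i"
  shows "(\<Sum>i\<in>I. a i) ^ 3 \<le> real (card I) ^ 3 * (\<Sum>i\<in>I. a i ^ 3)"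
proof (cases "I = {}")
  case False
  then obtain j where j: "j \<in> I" "a j = Max (a ` I)"
    using Max_in[of "a ` I"] I by fastforce
  have "(\<Sum>i\<in>I. a i) \<le> (\<Sum>i\<in>I. a j)"
    using I j(2) by (intro sum_mono) simp
  then have "(\<Sum>i\<in>I. a i) ^ 3 \<le> (real (card I) * a j) ^ 3"
    using a by (intro power_mono sum_nonneg) auto
  also have "\<dots> = real (card I) ^ 3 * a j ^ 3"
    by (rule power_mult_distrib)
  also have "\<dots> \<le> real (card I) ^ 3 * (\<Sum>i\<in>I. a i ^ 3)"
    using I j a by (intro mult_left_mono member_le_sum) auto
  finally show ?thesis .
qed simp

text \<open>For a centred normal variable with standard deviation \<open>s\<close> the third absolute moment is
  \<open>2 * sqrt (2 / pi) * s ^ 3\<close>; a constant centred variable vanishes almost surely.\<close>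

lemma gaussian_rv_moments:
  assumes N: "prob_space N" and Y: "gaussian_rv N Y" and mean: "(\<integral>\<omega>. Y \<omega> \<partial>N) = 0"
  shows "integrable N Y" and "integrable N (\<lambda>\<omega>. (Y \<omega>)\<^sup>2)" and "integrable N (\<lambda>\<omega>. \<bar>Y \<omega>\<bar> ^ 3)"
    and "(\<integral>\<omega>. \<bar>Y \<omega>\<bar> ^ 3 \<partial>N) \<le> 2 * sqrt (\<integral>\<omega>. (Y \<omega>)\<^sup>2 \<partial>N) ^ 3"
proof -
  interpret prob_space N by fact
  have Ym[measurable]: "Y \<in> borel_measurable N"
    using Y by (simp add: gaussian_rv_def)
  have "integrable N Y \<and> integrable N (\<lambda>\<omega>. (Y \<omega>)\<^sup>2) \<and> integrable N (\<lambda>\<omega>. \<bar>Y \<omega>\<bar> ^ 3) \<and>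
    (\<integral>\<omega>. \<bar>Y \<omega>\<bar> ^ 3 \<partial>N) \<le> 2 * sqrt (\<integral>\<omega>. (Y \<omega>)\<^sup>2 \<partial>N) ^ 3"
  proof -
    consider a s where "s > 0" "distributed N lborel Y (normal_density a s)"
      | a where "AE \<omega> in N. Y \<omega> = a"
      using Y by (auto simp: gaussian_rv_def)
    then show ?thesis
    proof cases
      case 1
      have a: "a = 0"
        using normal_distributed_expectation[OF 1] mean by simp
      note D = 1(2)[unfolded a]
      have i: "integrable N (\<lambda>\<omega>. g (Y \<omega>))" if "integrable lborel (\<lambda>x. normal_density 0 s x * g x)"
        "g \<in> borel_measurable borel" for g :: "real \<Rightarrow> real"
        using distributed_integrable[OF D, of g] that by simp
      have v: "(\<integral>\<omega>. (Y \<omega>)\<^sup>2 \<partial>N) = s\<^sup>2"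
        using normal_distributed_variance[OF 1(1) D] mean by simp
      have "(\<integral>\<omega>. \<bar>Y \<omega>\<bar> ^ 3 \<partial>N) = 2 * s ^ 3 * sqrt (2 / pi)"
        using distributed_integral[OF D, of "\<lambda>x. \<bar>x\<bar> ^ 3"] integral_normal_moment_abs_odd[OF 1(1), of 0 1]
        by (simp add: eval_nat_numeral)
      also have "\<dots> \<le> 2 * s ^ 3 * 1"
        using pi_gt3 1(1) by (intro mult_left_mono) auto
      finally show ?thesis
        using i[of "\<lambda>x. x"] i[of "\<lambda>x. x\<^sup>2"] i[of "\<lambda>x. \<bar>x\<bar> ^ 3"] 1(1) v
          integrable_normal_moment[OF 1(1), of 0 1] integrable_normal_moment[OF 1(1), of 0 2]
          integrable_normal_moment_abs[OF 1(1), of 0 3]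
        by simp
    next
      case 2
      have "(\<integral>\<omega>. Y \<omega> \<partial>N) = (\<integral>\<omega>. a \<partial>N)"
        using 2 by (intro integral_cong_AE) auto
      then have "a = 0"
        using mean by (simp add: prob_space)
      then have z: "AE \<omega> in N. Y \<omega> = 0"
        using 2 by simp
      have i: "integrable N (\<lambda>\<omega>. g (Y \<omega>))" "(\<integral>\<omega>. g (Y \<omega>) \<partial>N) = g 0"
        if [measurable]: "g \<in> borel_measurable borel" for g :: "real \<Rightarrow> real"
      proof -
        have ae: "AE \<omega> in N. g 0 = g (Y \<omega>)"
          using z by eventually_elim simp
        have "integrable N (\<lambda>\<omega>. g 0) = integrable N (\<lambda>\<omega>. g (Y \<omega>))"
          using ae by (intro integrable_cong_AE) auto
        then show "integrable N (\<lambda>\<omega>. g (Y \<omega>))"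
          by simp
        have "(\<integral>\<omega>. g 0 \<partial>N) = (\<integral>\<omega>. g (Y \<omega>) \<partial>N)"
          using ae by (intro integral_cong_AE) auto
        then show "(\<integral>\<omega>. g (Y \<omega>) \<partial>N) = g 0"
          by (simp add: prob_space)
      qed
      show ?thesis
        using i[of "\<lambda>x. x"] i[of "\<lambda>x. x\<^sup>2"] i[of "\<lambda>x. \<bar>x\<bar> ^ 3"] by simp
    qed
  qed
  then show "integrable N Y" "integrable N (\<lambda>\<omega>. (Y \<omega>)\<^sup>2)" "integrable N (\<lambda>\<omega>. \<bar>Y \<omega>\<bar> ^ 3)"
    "(\<integral>\<omega>. \<bar>Y \<omega>\<bar> ^ 3 \<partial>N) \<le> 2 * sqrt (\<integral>\<omega>. (Y \<omega>)\<^sup>2 \<partial>N) ^ 3"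
    by auto
qed

text \<open>One-point marginals are the linear combinations with a single coefficient \<open>1\<close>.\<close>

lemma brownian_motion_gaussian:
  assumes B: "brownian_motion N I M B" and i: "i \<in> I" "t \<in> {0..1}"
  shows "gaussian_rv N (B i t)"
proof -
  have "\<forall>J c. finite J \<and> J \<subseteq> I \<times> {0..1} \<longrightarrow> gaussian_rv N (\<lambda>\<omega>. \<Sum>(i, t)\<in>J. c i t * B i t \<omega>)"
    using B unfolding brownian_motion_def centered_gaussian_process_def by (elim conjE)
  from this[rule_format, of "{(i, t)}" "\<lambda>_ _. 1"] show ?thesis
    using i by simp
qed

lemma brownian_motion_measurable:
  assumes B: "brownian_motion N I M B" and i: "i \<in> I" "t \<in> {0..1}"
  shows "B i t \<in> borel_measurable N"
  using brownian_motion_gaussian[OF assms] by (simp add: gaussian_rv_def)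

lemma brownian_motion_moments:
  assumes B: "brownian_motion N I M B" and t: "t \<in> {0..1}"
  shows "i \<in> I \<Longrightarrow> (\<integral>\<omega>. B i t \<omega> \<partial>N) = 0"
    and "i \<in> I \<Longrightarrow> j \<in> I \<Longrightarrow> (\<integral>\<omega>. B i t \<omega> * B j t \<omega> \<partial>N) = t * M i j"
    and "i \<in> I \<Longrightarrow> integrable N (\<lambda>\<omega>. \<bar>B i t \<omega>\<bar> ^ 3)"
    and "i \<in> I \<Longrightarrow> (\<integral>\<omega>. \<bar>B i t \<omega>\<bar> ^ 3 \<partial>N) \<le> 2 * sqrt (t * M i i) ^ 3"
proof -
  have N: "prob_space N"
    using B by (simp add: brownian_motion_def)
  have mean: "(\<integral>\<omega>. B i t \<omega> \<partial>N) = 0" if "i \<in> I" for i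
    using B t that by (auto simp: brownian_motion_def centered_gaussian_process_def)
  then show "i \<in> I \<Longrightarrow> (\<integral>\<omega>. B i t \<omega> \<partial>N) = 0" .
  have cov: "(\<integral>\<omega>. B i t \<omega> * B j t \<omega> \<partial>N) = t * M i j" if "i \<in> I" "j \<in> I" for i j
  proof -
    have "covariance N (B i t) (B j t) = t * M i j"
      using B t that by (simp add: brownian_motion_def)
    then show ?thesis
      using that mean by (simp add: covariance_def)
  qed
  then show "i \<in> I \<Longrightarrow> j \<in> I \<Longrightarrow> (\<integral>\<omega>. B i t \<omega> * B j t \<omega> \<partial>N) = t * M i j" .
  show "i \<in> I \<Longrightarrow> integrable N (\<lambda>\<omega>. \<bar>B i t \<omega>\<bar> ^ 3)"
    and "i \<in> I \<Longrightarrow> (\<integral>\<omega>. \<bar>B i t \<omega>\<bar> ^ 3 \<partial>N) \<le> 2 * sqrt (t * M i i) ^ 3"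
    using gaussian_rv_moments(3,4)[OF N brownian_motion_gaussian[OF B _ t] mean]
    by (auto simp: power2_eq_square cov)
qed

lemma increment_measurable:
  assumes B: "brownian_motion N I M B" and "s \<in> {0..1}" "t \<in> {0..1}"
  shows "increment I B s t \<in> N \<rightarrow>\<^sub>M (\<Pi>\<^sub>M i\<in>I. borel)"
  unfolding increment_def[abs_def] using brownian_motion_measurable[OF B] assms(2,3)
  by (intro measurable_restrict borel_measurable_diff) auto

text \<open>Since \<open>B i 0 = 0\<close> only almost surely, the law of the increment from \<open>0\<close> to \<open>h\<close> is compared with the law of
  \<open>B i h\<close>, whose moments are prescribed. The third moment is of order \<open>h powr (3 / 2)\<close>: summed over \<open>1 / h\<close>
  increments this tends to \<open>0\<close>, as Lindeberg's method needs.\<close>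

lemma brownian_increment_law:
  assumes B: "brownian_motion N I M B" and I: "finite I" and h: "h \<in> {0..1}"
    and unit: "\<And>i. i \<in> I \<Longrightarrow> M i i = 1"
  defines "\<nu> \<equiv> distr N (\<Pi>\<^sub>M i\<in>I. borel) (increment I B 0 h)"
  shows "prob_space \<nu>" and "sets \<nu> = sets (\<Pi>\<^sub>M i\<in>I. borel)"
    and "i \<in> I \<Longrightarrow> (\<integral>y. y i \<partial>\<nu>) = 0"
    and "i \<in> I \<Longrightarrow> j \<in> I \<Longrightarrow> (\<integral>y. y i * y j \<partial>\<nu>) = h * M i j"
    and "integrable \<nu> (\<lambda>y. (\<Sum>i\<in>I. \<bar>y i\<bar>) ^ 3)"
    and "(\<integral>y. (\<Sum>i\<in>I. \<bar>y i\<bar>) ^ 3 \<partial>\<nu>) \<le> real (card I) ^ 3 * (real (card I) * (2 * sqrt h ^ 3))"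
proof -
  interpret N: prob_space N
    using B by (simp add: brownian_motion_def)
  have inc: "increment I B 0 h \<in> N \<rightarrow>\<^sub>M (\<Pi>\<^sub>M i\<in>I. borel)"
    using B h by (intro increment_measurable) auto
  have Bm[measurable]: "B i t \<in> borel_measurable N" if "i \<in> I" "t \<in> {0..1}" for i t
    using brownian_motion_measurable[OF B] that .
  show "prob_space \<nu>"
    unfolding \<nu>_def by (rule N.prob_space_distr[OF inc])
  show "sets \<nu> = sets (\<Pi>\<^sub>M i\<in>I. borel)"
    by (simp add: \<nu>_def)
  have ae: "AE \<omega> in N. B i 0 \<omega> = 0" if "i \<in> I" for i
    using B that by (auto simp: brownian_motion_def)
  have ae': "AE \<omega> in N. \<forall>i\<in>I. B i 0 \<omega> = 0"
    using ae I by (simp add: AE_finite_all)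
  have zero: "(0::real) \<in> {0..1}"
    by simp
  have transfer: "integrable \<nu> g \<longleftrightarrow> integrable N (\<lambda>\<omega>. g (\<lambda>i\<in>I. B i h \<omega>))"
    "(\<integral>y. g y \<partial>\<nu>) = (\<integral>\<omega>. g (\<lambda>i\<in>I. B i h \<omega>) \<partial>N)"
    if g[measurable]: "g \<in> borel_measurable (\<Pi>\<^sub>M i\<in>I. borel)" for g :: "(nat \<Rightarrow> real) \<Rightarrow> real"
  proof -
    have m: "(\<lambda>\<omega>. \<lambda>i\<in>I. B i h \<omega>) \<in> N \<rightarrow>\<^sub>M (\<Pi>\<^sub>M i\<in>I. borel)"
      using h by (intro measurable_restrict) auto
    have eq: "AE \<omega> in N. g (increment I B 0 h \<omega>) = g (\<lambda>i\<in>I. B i h \<omega>)"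
      using ae' by eventually_elim (auto simp: increment_def intro!: arg_cong[of _ _ g])
    show "integrable \<nu> g \<longleftrightarrow> integrable N (\<lambda>\<omega>. g (\<lambda>i\<in>I. B i h \<omega>))"
      unfolding \<nu>_def integrable_distr_eq[OF inc g]
      using eq measurable_compose[OF inc g] measurable_compose[OF m g] by (intro integrable_cong_AE)
    show "(\<integral>y. g y \<partial>\<nu>) = (\<integral>\<omega>. g (\<lambda>i\<in>I. B i h \<omega>) \<partial>N)"
      unfolding \<nu>_def integral_distr[OF inc g]
      using eq measurable_compose[OF inc g] measurable_compose[OF m g] by (intro integral_cong_AE)
  qed
  note mom = brownian_motion_moments[OF B h]
  show "(\<integral>y. y i \<partial>\<nu>) = 0" if "i \<in> I"
    using transfer(2)[of "\<lambda>y. y i"] mom(1) that by simp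
  show "(\<integral>y. y i * y j \<partial>\<nu>) = h * M i j" if "i \<in> I" "j \<in> I"
    using transfer(2)[of "\<lambda>y. y i * y j"] mom(2) that by simp
  let ?b = "\<lambda>\<omega>. real (card I) ^ 3 * (\<Sum>i\<in>I. \<bar>B i h \<omega>\<bar> ^ 3)"
  have b: "integrable N ?b"
    using mom(3) by auto
  have le: "(\<Sum>i\<in>I. \<bar>B i h \<omega>\<bar>) ^ 3 \<le> ?b \<omega>" for \<omega>
    using cube_sum_le[OF I, of "\<lambda>i. \<bar>B i h \<omega>\<bar>"] by simp
  have int: "integrable N (\<lambda>\<omega>. (\<Sum>i\<in>I. \<bar>B i h \<omega>\<bar>) ^ 3)"
  proof (rule Bochner_Integration.integrable_bound[OF b])
    show "(\<lambda>\<omega>. (\<Sum>i\<in>I. \<bar>B i h \<omega>\<bar>) ^ 3) \<in> borel_measurable N"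
      using h by measurable
    show "AE \<omega> in N. norm ((\<Sum>i\<in>I. \<bar>B i h \<omega>\<bar>) ^ 3) \<le> norm (?b \<omega>)"
      using le by (intro AE_I2) (auto simp: sum_nonneg intro: order_trans[OF _ abs_ge_self])
  qed
  have g: "(\<lambda>y. (\<Sum>i\<in>I. \<bar>y i\<bar>) ^ 3) \<in> borel_measurable (\<Pi>\<^sub>M i\<in>I. borel :: real measure)"
    by measurable
  show "integrable \<nu> (\<lambda>y. (\<Sum>i\<in>I. \<bar>y i\<bar>) ^ 3)"
    unfolding transfer(1)[OF g] using int by simp
  have "(\<integral>y. (\<Sum>i\<in>I. \<bar>y i\<bar>) ^ 3 \<partial>\<nu>) = (\<integral>\<omega>. (\<Sum>i\<in>I. \<bar>B i h \<omega>\<bar>) ^ 3 \<partial>N)"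
    unfolding transfer(2)[OF g] by simp
  also have "\<dots> \<le> (\<integral>\<omega>. ?b \<omega> \<partial>N)"
    using le by (intro integral_mono int b)
  also have "\<dots> = real (card I) ^ 3 * (\<Sum>i\<in>I. \<integral>\<omega>. \<bar>B i h \<omega>\<bar> ^ 3 \<partial>N)"
    using mom(3) by simp
  also have "\<dots> \<le> real (card I) ^ 3 * (\<Sum>i\<in>I. 2 * sqrt h ^ 3)"
    using mom(4) unit by (intro mult_left_mono sum_mono) fastforce+
  finally show "(\<integral>y. (\<Sum>i\<in>I. \<bar>y i\<bar>) ^ 3 \<partial>\<nu>) \<le> real (card I) ^ 3 * (real (card I) * (2 * sqrt h ^ 3))"
    by simp
qed

text \<open>The increments over a grid of mesh \<open>1 / n\<close> form an iid sample, by independence and stationarity of the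
  increments. This sample plays the part of the Gaussian steps in Lindeberg's method.\<close>

lemma brownian_grid_increments:
  assumes B: "brownian_motion N I M B" and n: "0 < n"
  shows "distr N (\<Pi>\<^sub>M j\<in>{..<n}. \<Pi>\<^sub>M i\<in>I. borel)
      (\<lambda>\<omega>. \<lambda>j\<in>{..<n}. increment I B (real j / real n) (real (j + 1) / real n) \<omega>)
    = (\<Pi>\<^sub>M j\<in>{..<n}. distr N (\<Pi>\<^sub>M i\<in>I. borel) (increment I B 0 (1 / real n)))"
proof -
  interpret N: prob_space N
    using B by (simp add: brownian_motion_def)
  let ?t = "\<lambda>j. real j / real n"
  have grid: "?t j \<in> {0..1}" if "j \<le> n" for j
    using that n by simp
  have "mono_on {0..n} ?t \<and> ?t ` {0..n} \<subseteq> {0..1}"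
    using n by (auto simp: mono_on_def divide_right_mono)
  then have "N.indep_vars (\<lambda>_. \<Pi>\<^sub>M i\<in>I. borel) (\<lambda>j. increment I B (?t j) (?t (j + 1))) {..<n}"
    using B unfolding brownian_motion_def by blast
  then have "distr N (\<Pi>\<^sub>M j\<in>{..<n}. \<Pi>\<^sub>M i\<in>I. borel)
      (\<lambda>\<omega>. \<lambda>j\<in>{..<n}. increment I B (?t j) (?t (j + 1)) \<omega>)
    = (\<Pi>\<^sub>M j\<in>{..<n}. distr N (\<Pi>\<^sub>M i\<in>I. borel) (increment I B (?t j) (?t (j + 1))))"
    using n by (subst (asm) N.indep_vars_iff_distr_eq_PiM')
      (auto intro!: increment_measurable[OF B] grid simp del: of_nat_Suc of_nat_add)
  also have "\<dots> = (\<Pi>\<^sub>M j\<in>{..<n}. distr N (\<Pi>\<^sub>M i\<in>I. borel) (increment I B 0 (1 / real n)))"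
  proof (intro PiM_cong refl)
    fix j assume j: "j \<in> {..<n}"
    have "?t (j + 1) = ?t j + 1 / real n"
      by (simp add: add_divide_distrib)
    moreover have "?t j + 1 / real n \<le> 1"
      using n j by (simp add: add_divide_distrib[symmetric])
    ultimately show "distr N (\<Pi>\<^sub>M i\<in>I. borel) (increment I B (?t j) (?t (j + 1)))
        = distr N (\<Pi>\<^sub>M i\<in>I. borel) (increment I B 0 (1 / real n))"
      using B unfolding brownian_motion_def by simp
  qed
  finally show ?thesis .
qed

section \<open>Letter counts as random walks\<close>

text \<open>The step of the normalised walks caused by one letter \<open>c\<close>: the \<open>r\<close>-th walk counts occurrences of \<open>\<alpha> r\<close> minus
  occurrences of \<open>\<alpha> (r + 1)\<close>, centred, and scaled to variance \<open>1 / n\<close>.\<close>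

definition letter_step :: "nat \<Rightarrow> (nat \<Rightarrow> 'c) \<Rightarrow> (nat \<Rightarrow> real) \<Rightarrow> nat \<Rightarrow> 'c \<Rightarrow> nat \<Rightarrow> real" where
  "letter_step m \<alpha> p n c = (\<lambda>r\<in>{1..m-1}.
     (of_bool (c = \<alpha> r) - of_bool (c = \<alpha> (r + 1)) - mu p r) / (sigma p r * sqrt (real n)))"

text \<open>The steps have mean \<open>0\<close> and covariance \<open>rho p / n\<close>, exactly as the increments of the Brownian motion over an
  interval of length \<open>1 / n\<close>. Indicators of different letters have product \<open>0\<close>, so only equal or neighbouring
  walks receive a contribution besides \<open>- mu p i * mu p j\<close>.\<close>

lemma letter_step_law:
  fixes p :: "nat \<Rightarrow> real" and \<alpha> :: "nat \<Rightarrow> 'c"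
  assumes P: "prob_space P" and \<alpha>: "inj_on \<alpha> {1..m}"
    and Y: "Y \<in> P \<rightarrow>\<^sub>M count_space (\<alpha> ` {1..m})"
    and Yp: "\<And>r. r \<in> {1..m} \<Longrightarrow> measure P {\<omega> \<in> space P. Y \<omega> = \<alpha> r} = p r"
    and p: "\<And>r. r \<in> {1..m} \<Longrightarrow> 0 < p r \<and> p r < 1"
    and n: "0 < n"
  defines "I \<equiv> {1..m-1}"
  defines "\<mu> \<equiv> distr P (\<Pi>\<^sub>M i\<in>I. borel) (\<lambda>\<omega>. letter_step m \<alpha> p n (Y \<omega>))"
  shows "prob_space \<mu>" and "sets \<mu> = sets (\<Pi>\<^sub>M i\<in>I. borel)"
    and "i \<in> I \<Longrightarrow> (\<integral>y. y i \<partial>\<mu>) = 0"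
    and "i \<in> I \<Longrightarrow> j \<in> I \<Longrightarrow> (\<integral>y. y i * y j \<partial>\<mu>) = 1 / real n * rho p i j"
    and "integrable \<mu> (\<lambda>y. (\<Sum>i\<in>I. \<bar>y i\<bar>) ^ 3)"
    and "(\<integral>y. (\<Sum>i\<in>I. \<bar>y i\<bar>) ^ 3 \<partial>\<mu>) \<le> (\<Sum>i\<in>I. 2 / sigma p i) ^ 3 * sqrt (1 / real n) ^ 3"
proof -
  interpret prob_space P by fact
  define e where "e r \<omega> = (of_bool (Y \<omega> = \<alpha> r) :: real)" for r \<omega>
  have Ic: "r \<in> {1..m}" "r + 1 \<in> {1..m}" if "r \<in> I" for r
    using that by (auto simp: I_def)
  have \<sigma>: "0 < sigma p r" "(sigma p r)\<^sup>2 = p r + p (r + 1) - (mu p r)\<^sup>2" if "r \<in> I" for r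
    using sigma_pos[of p r] p[OF Ic(1)[OF that]] p[OF Ic(2)[OF that]] by (auto simp: mu_def)
  have step_meas: "(\<lambda>\<omega>. letter_step m \<alpha> p n (Y \<omega>)) \<in> P \<rightarrow>\<^sub>M (\<Pi>\<^sub>M i\<in>I. borel)"
    by (rule measurable_compose[OF Y]) (auto simp: letter_step_def I_def space_PiM)
  show "prob_space \<mu>"
    unfolding \<mu>_def by (rule prob_space_distr[OF step_meas])
  show "sets \<mu> = sets (\<Pi>\<^sub>M i\<in>I. borel)"
    by (simp add: \<mu>_def)
  have em[measurable]: "e r \<in> borel_measurable P" for r
    unfolding e_def[abs_def] by (rule measurable_compose[OF Y]) simp
  have e_int[simp]: "integrable P (e r)" "integrable P (\<lambda>\<omega>. e r \<omega> * e s \<omega>)" for r s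
  proof -
    show "integrable P (e r)"
      by (rule integrable_const_bound[of _ 1]) (auto simp: e_def[of r])
    show "integrable P (\<lambda>\<omega>. e r \<omega> * e s \<omega>)"
    proof (rule integrable_const_bound[of _ 1])
      show "AE \<omega> in P. norm (e r \<omega> * e s \<omega>) \<le> 1"
        by (auto simp: e_def)
    qed measurable
  qed
  have Ee: "(\<integral>\<omega>. e r \<omega> \<partial>P) = p r" if "r \<in> {1..m}" for r
  proof -
    have "(\<integral>\<omega>. e r \<omega> \<partial>P) = (\<integral>\<omega>. indicator {\<omega> \<in> space P. Y \<omega> = \<alpha> r} \<omega> \<partial>P)"
      by (intro Bochner_Integration.integral_cong) (auto simp: e_def indicator_def)
    moreover have "{\<omega> \<in> space P. Y \<omega> = \<alpha> r} \<inter> space P = {\<omega> \<in> space P. Y \<omega> = \<alpha> r}"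
      by auto
    ultimately show ?thesis
      using Yp[OF that] by simp
  qed
  have Eee: "(\<integral>\<omega>. e r \<omega> * e s \<omega> \<partial>P) = (if r = s then p r else 0)" if "r \<in> {1..m}" "s \<in> {1..m}" for r s
  proof -
    have "e r \<omega> * e s \<omega> = (if r = s then e r \<omega> else 0)" for \<omega>
      using that \<alpha> by (auto simp: e_def dest: inj_onD)
    then have "(\<integral>\<omega>. e r \<omega> * e s \<omega> \<partial>P) = (\<integral>\<omega>. (if r = s then e r \<omega> else 0) \<partial>P)"
      by (simp only:)
    then show ?thesis
      using Ee[OF that(1)] by (cases "r = s") auto
  qed
  define z where "z r \<omega> = e r \<omega> - e (r + 1) \<omega> - mu p r" for r \<omega>
  have zm[measurable]: "z r \<in> borel_measurable P" for r
    unfolding z_def[abs_def] by measurable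
  have step: "letter_step m \<alpha> p n (Y \<omega>) r = z r \<omega> / (sigma p r * sqrt (real n))" if "r \<in> I" for r \<omega>
    using that by (simp add: letter_step_def I_def z_def e_def)
  have Ez: "(\<integral>\<omega>. z r \<omega> \<partial>P) = 0" if "r \<in> I" for r
    using Ee[OF Ic(1)[OF that]] Ee[OF Ic(2)[OF that]] by (simp add: z_def mu_def prob_space)
  have Ezz: "(\<integral>\<omega>. z r \<omega> * z s \<omega> \<partial>P) = sigma p r * sigma p s * rho p r s" if rs: "r \<in> I" "s \<in> I" for r s
  proof -
    have "z r \<omega> * z s \<omega> = e r \<omega> * e s \<omega> - e r \<omega> * e (s + 1) \<omega> - e (r + 1) \<omega> * e s \<omega> + e (r + 1) \<omega> * e (s + 1) \<omega>
      - mu p s * e r \<omega> + mu p s * e (r + 1) \<omega> - mu p r * e s \<omega> + mu p r * e (s + 1) \<omega> + mu p r * mu p s" for \<omega>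
      by (simp add: z_def algebra_simps)
    then have E0: "(\<integral>\<omega>. z r \<omega> * z s \<omega> \<partial>P)
      = (\<integral>\<omega>. e r \<omega> * e s \<omega> \<partial>P) - (\<integral>\<omega>. e r \<omega> * e (s + 1) \<omega> \<partial>P) - (\<integral>\<omega>. e (r + 1) \<omega> * e s \<omega> \<partial>P)
        + (\<integral>\<omega>. e (r + 1) \<omega> * e (s + 1) \<omega> \<partial>P)
        - mu p s * p r + mu p s * p (r + 1) - mu p r * p s + mu p r * p (s + 1) + mu p r * mu p s"
      using Ee[OF Ic(1)[OF rs(1)]] Ee[OF Ic(2)[OF rs(1)]] Ee[OF Ic(1)[OF rs(2)]] Ee[OF Ic(2)[OF rs(2)]]
      by (simp add: prob_space)
    have cross: "t - mu p s * p r + mu p s * p (r + 1) - mu p r * p s + mu p r * p (s + 1) + mu p r * mu p s = t - mu p r * mu p s" for t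
      by (simp add: mu_def algebra_simps)
    have E: "(\<integral>\<omega>. z r \<omega> * z s \<omega> \<partial>P) = (if r = s then p r else 0) - (if r = s + 1 then p r else 0)
        - (if r + 1 = s then p (r + 1) else 0) + (if r + 1 = s + 1 then p (r + 1) else 0) - mu p r * mu p s"
      unfolding E0 cross using Eee Ic rs by simp
    show ?thesis
    proof (cases "r = s")
      case True
      then show ?thesis
        using \<sigma>(2)[OF rs(1)] unfolding E by (simp add: rho_def power2_eq_square)
    next
      case False
      then show ?thesis
        using \<sigma>(1)[OF rs(1)] \<sigma>(1)[OF rs(2)] unfolding E by (auto simp: rho_def field_simps)
    qed
  qed
  have c[measurable]: "(\<lambda>y. y i) \<in> borel_measurable (\<Pi>\<^sub>M i\<in>I. borel :: real measure)" if "i \<in> I" for i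
    using that by simp
  show "(\<integral>y. y i \<partial>\<mu>) = 0" if "i \<in> I"
    unfolding \<mu>_def integral_distr[OF step_meas c[OF that]] using Ez[OF that] by (simp add: step that)
  show "(\<integral>y. y i * y j \<partial>\<mu>) = 1 / real n * rho p i j" if ij: "i \<in> I" "j \<in> I"
  proof -
    have "(\<integral>y. y i * y j \<partial>\<mu>) = (\<integral>\<omega>. z i \<omega> * z j \<omega> / (sigma p i * sigma p j * real n) \<partial>P)"
      unfolding \<mu>_def using ij n by (subst integral_distr[OF step_meas]) (auto simp: step mult_ac)
    also have "\<dots> = 1 / real n * rho p i j"
      using Ezz[OF ij] \<sigma>(1)[OF ij(1)] \<sigma>(1)[OF ij(2)] n by simp
    finally show ?thesis .
  qed
  have bound: "(\<Sum>i\<in>I. \<bar>letter_step m \<alpha> p n (Y \<omega>) i\<bar>) ^ 3 \<le> (\<Sum>i\<in>I. 2 / sigma p i) ^ 3 * sqrt (1 / real n) ^ 3" for \<omega>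
  proof -
    have "\<bar>letter_step m \<alpha> p n (Y \<omega>) i\<bar> \<le> 2 / sigma p i * sqrt (1 / real n)" if i: "i \<in> I" for i
    proof -
      have "\<bar>z i \<omega>\<bar> \<le> 2"
        using p[OF Ic(1)[OF i]] p[OF Ic(2)[OF i]] by (auto simp: z_def e_def mu_def)
      then have "\<bar>z i \<omega>\<bar> / (sigma p i * sqrt (real n)) \<le> 2 / (sigma p i * sqrt (real n))"
        using \<sigma>(1)[OF i] by (intro divide_right_mono) auto
      then show ?thesis
        using \<sigma>(1)[OF i] by (simp add: step[OF i] real_sqrt_divide abs_mult)
    qed
    then have "(\<Sum>i\<in>I. \<bar>letter_step m \<alpha> p n (Y \<omega>) i\<bar>) \<le> (\<Sum>i\<in>I. 2 / sigma p i) * sqrt (1 / real n)"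
      unfolding sum_distrib_right by (intro sum_mono)
    then show ?thesis
      unfolding power_mult_distrib[symmetric] by (intro power_mono sum_nonneg) auto
  qed
  have g: "(\<lambda>y. (\<Sum>i\<in>I. \<bar>y i\<bar>) ^ 3) \<in> borel_measurable (\<Pi>\<^sub>M i\<in>I. borel :: real measure)"
    by measurable
  have int: "integrable P (\<lambda>\<omega>. (\<Sum>i\<in>I. \<bar>letter_step m \<alpha> p n (Y \<omega>) i\<bar>) ^ 3)"
    using bound measurable_compose[OF step_meas g]
    by (intro integrable_const_bound[of _ "(\<Sum>i\<in>I. 2 / sigma p i) ^ 3 * sqrt (1 / real n) ^ 3"])
       (auto simp: sum_nonneg)
  then show "integrable \<mu> (\<lambda>y. (\<Sum>i\<in>I. \<bar>y i\<bar>) ^ 3)"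
    unfolding \<mu>_def integrable_distr_eq[OF step_meas g] .
  show "(\<integral>y. (\<Sum>i\<in>I. \<bar>y i\<bar>) ^ 3 \<partial>\<mu>) \<le> (\<Sum>i\<in>I. 2 / sigma p i) ^ 3 * sqrt (1 / real n) ^ 3"
    unfolding \<mu>_def integral_distr[OF step_meas g] using int bound
    by (intro integral_le_const) auto
qed

text \<open>Used with \<open>d\<close> the centred letter indicators and \<open>u\<close> the cut weights without the factor \<open>sigma\<close>,
  which vanish at \<open>0\<close> and at \<open>m\<close>.\<close>

lemma summation_by_parts:
  fixes u d :: "nat \<Rightarrow> real"
  assumes "1 \<le> m" "u 0 = 0" "u m = 0"
  shows "(\<Sum>i=1..m-1. u i * (d i - d (i + 1))) = (\<Sum>i=1..m. d i * (u i - u (i - 1)))"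
proof -
  have "(\<Sum>i=1..M. u i * (d i - d (i + 1))) = (\<Sum>i=1..M+1. d i * (u i - u (i - 1))) - d (M + 1) * u (M + 1)" for M
    using assms(2) by (induction M) (auto simp: algebra_simps)
  from this[of "m - 1"] show ?thesis
    using assms by simp
qed

text \<open>The coefficient of the step \<open>j\<close> of the walk \<open>i\<close> in the value of the cut \<open>k\<close>. Steps are numbered from \<open>0\<close>, so step \<open>j\<close>
  belongs to the letter at position \<open>j + 1\<close>, and \<open>j < k i\<close> says that this position is not beyond the cut.
  The term \<open>- i / m\<close> gives the first sum in the limit.\<close>

definition cut_weight :: "nat \<Rightarrow> (nat \<Rightarrow> real) \<Rightarrow> (nat \<Rightarrow> nat) \<Rightarrow> nat \<Rightarrow> nat \<Rightarrow> real" where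
  "cut_weight m p k j i = (of_bool (j < k i) - real i / real m) * sigma p i"

definition cut_penalty :: "nat \<Rightarrow> (nat \<Rightarrow> real) \<Rightarrow> nat \<Rightarrow> (nat \<Rightarrow> nat) \<Rightarrow> real" where
  "cut_penalty m p n k = (\<Sum>r=1..m. (p_max m p - p r) * (real (k r) - real (k (r - 1)))) / sqrt (real n)"

definition cut_max :: "nat \<Rightarrow> (nat \<Rightarrow> real) \<Rightarrow> nat \<Rightarrow> (nat \<Rightarrow> nat \<Rightarrow> real) \<Rightarrow> real" where
  "cut_max m p n y = Max ((\<lambda>k. - cut_penalty m p n k + (\<Sum>j<n. \<Sum>i\<in>{1..m-1}. cut_weight m p k j i * y j i)) ` cuts m n)"

text \<open>The value of a cut is the number of positions that carry the letter of their block, centred by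
  \<open>p_max m p * n\<close>. Each block \<open>r\<close> is centred by \<open>p r\<close> times its length instead, and the difference is the
  penalty. Summation by parts over the letters expresses the centred indicators through the walks;
  the \<open>1 / m\<close>-terms vanish because the centred indicators of all letters sum to \<open>0\<close>.\<close>

lemma LI_eq_cut_max:
  fixes x :: "nat \<Rightarrow> 'c::linorder"
  assumes m: "1 \<le> m" and \<alpha>: "strict_mono_on {1..m} \<alpha>" and x: "\<And>j. j \<in> {1..n} \<Longrightarrow> x j \<in> \<alpha> ` {1..m}"
    and p: "\<And>r. r \<in> {1..m} \<Longrightarrow> 0 < p r \<and> p r < 1" "(\<Sum>r=1..m. p r) = 1" and n: "0 < n"
  shows "(real (LI x n) - p_max m p * real n) / sqrt (real n)
    = cut_max m p n (\<lambda>j. letter_step m \<alpha> p n (x (j + 1)))"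
proof -
  define e where "e j i = (of_bool (x (j + 1) = \<alpha> i) :: real)" for j i
  have \<sigma>: "0 < sigma p i" if "i \<in> {1..m-1}" for i
    using that p(1)[of i] p(1)[of "i + 1"] by (intro sigma_pos) auto
  have e1: "(\<Sum>i=1..m. e j i) = 1" if j: "j < n" for j
  proof -
    obtain r where r: "r \<in> {1..m}" "x (j + 1) = \<alpha> r"
      using x[of "j + 1"] j by auto
    have "e j i = of_bool (i = r)" if "i \<in> {1..m}" for i
      using r that strict_mono_on_imp_inj_on[OF \<alpha>] by (auto simp: e_def dest: inj_onD)
    then have "(\<Sum>i=1..m. e j i) = (\<Sum>i=1..m. of_bool (i = r))"
      by (intro sum.cong) auto
    also have "\<dots> = 1"
      using r(1) by (simp add: of_bool_def)
    finally show ?thesis .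
  qed
  have key: "(real (\<Sum>r=1..m. card {j \<in> {k (r - 1)<..k r}. x j = \<alpha> r}) - p_max m p * real n) / sqrt (real n)
    = - cut_penalty m p n k + (\<Sum>j<n. \<Sum>i\<in>{1..m-1}. cut_weight m p k j i * letter_step m \<alpha> p n (x (j + 1)) i)"
    if k: "k \<in> cuts m n" for k
  proof -
    have kmn: "k 0 = 0" "k m = n"
      using k by (auto simp: cuts_def)
    have inner: "(\<Sum>i=1..m-1. cut_weight m p k j i * letter_step m \<alpha> p n (x (j + 1)) i) * sqrt (real n)
        = (\<Sum>i=1..m. (e j i - p i) * of_bool (k (i - 1) \<le> j \<and> j < k i))" if j: "j < n" for j
    proof -
      let ?u = "\<lambda>i. of_bool (j < k i) - real i / real m" and ?d = "\<lambda>i. e j i - p i"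
      have "(\<Sum>i=1..m-1. cut_weight m p k j i * letter_step m \<alpha> p n (x (j + 1)) i) * sqrt (real n)
          = (\<Sum>i=1..m-1. ?u i * (?d i - ?d (i + 1)))"
        unfolding sum_distrib_right
      proof (rule sum.cong)
        fix i assume i: "i \<in> {1..m-1}"
        have "letter_step m \<alpha> p n (x (j + 1)) i = (e j i - e j (i + 1) - mu p i) / (sigma p i * sqrt (real n))"
          using i by (simp add: letter_step_def e_def)
        then show "cut_weight m p k j i * letter_step m \<alpha> p n (x (j + 1)) i * sqrt (real n) = ?u i * (?d i - ?d (i + 1))"
          using \<sigma>[OF i] n by (simp add: cut_weight_def mu_def)
      qed simp
      also have "\<dots> = (\<Sum>i=1..m. ?d i * (?u i - ?u (i - 1)))"
        using m kmn j by (intro summation_by_parts) auto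
      also have "\<dots> = (\<Sum>i=1..m. ?d i * of_bool (k (i - 1) \<le> j \<and> j < k i) - ?d i * (1 / real m))"
      proof (rule sum.cong)
        fix i assume i: "i \<in> {1..m}"
        have "k (i - 1) \<le> k i"
          using k i by (auto simp: cuts_def)
        then have "?u i - ?u (i - 1) = of_bool (k (i - 1) \<le> j \<and> j < k i) - 1 / real m"
          using i m by (auto simp: of_nat_diff diff_divide_distrib)
        then show "?d i * (?u i - ?u (i - 1)) = ?d i * of_bool (k (i - 1) \<le> j \<and> j < k i) - ?d i * (1 / real m)"
          by (simp only: right_diff_distrib)
      qed simp
      also have "\<dots> = (\<Sum>i=1..m. ?d i * of_bool (k (i - 1) \<le> j \<and> j < k i)) - (\<Sum>i=1..m. ?d i) * (1 / real m)"
        unfolding sum_distrib_right by (rule sum_subtractf)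
      also have "(\<Sum>i=1..m. ?d i) = 0"
        using e1[OF j] p(2) by (simp add: sum_subtractf)
      finally show ?thesis
        by simp
    qed
    have block: "(\<Sum>j<n. (e j i - p i) * of_bool (k (i - 1) \<le> j \<and> j < k i))
        = real (card {j \<in> {k (i - 1)<..k i}. x j = \<alpha> i}) - p i * (real (k i) - real (k (i - 1)))"
      if i: "i \<in> {1..m}" for i
    proof -
      have le: "k (i - 1) \<le> k i" "k i \<le> n"
        using k i by (auto simp: cuts_def)
      have "(\<Sum>j<n. (e j i - p i) * of_bool (k (i - 1) \<le> j \<and> j < k i)) = (\<Sum>j\<in>{k (i - 1)..<k i}. e j i - p i)"
        using le by (intro sum.mono_neutral_cong_right) auto
      also have "\<dots> = (\<Sum>j\<in>{k (i - 1)..<k i}. e j i) - p i * (real (k i) - real (k (i - 1)))"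
        using le by (simp add: sum_subtractf of_nat_diff)
      also have "(\<Sum>j\<in>{k (i - 1)..<k i}. e j i) = (\<Sum>j\<in>{k (i - 1)<..k i}. of_bool (x j = \<alpha> i))"
        unfolding e_def by (rule sum.reindex_bij_witness[of _ "\<lambda>j. j - 1" Suc]) auto
      also have "\<dots> = real (card {j \<in> {k (i - 1)<..k i}. x j = \<alpha> i})"
        by (simp add: of_bool_def sum.If_cases Int_def)
      finally show ?thesis .
    qed
    have n': "(\<Sum>r=1..m. real (k r) - real (k (r - 1))) = real n"
      using sum_increments[of "\<lambda>r. real (k r)" m] kmn by simp
    have "(\<Sum>j<n. \<Sum>i\<in>{1..m-1}. cut_weight m p k j i * letter_step m \<alpha> p n (x (j + 1)) i) * sqrt (real n)
        = (\<Sum>j<n. \<Sum>i=1..m. (e j i - p i) * of_bool (k (i - 1) \<le> j \<and> j < k i))"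
      unfolding sum_distrib_right[of _ "{..<n}"] using inner by (intro sum.cong) auto
    also have "\<dots> = (\<Sum>i=1..m. real (card {j \<in> {k (i - 1)<..k i}. x j = \<alpha> i}) - p i * (real (k i) - real (k (i - 1))))"
      by (subst sum.swap) (intro sum.cong block refl)
    finally have main: "(\<Sum>j<n. \<Sum>i\<in>{1..m-1}. cut_weight m p k j i * letter_step m \<alpha> p n (x (j + 1)) i) * sqrt (real n)
      = real (\<Sum>r=1..m. card {j \<in> {k (r - 1)<..k r}. x j = \<alpha> r}) - (\<Sum>i=1..m. p i * (real (k i) - real (k (i - 1))))"
      by (simp add: sum_subtractf)
    have "cut_penalty m p n k * sqrt (real n) = (\<Sum>r=1..m. p_max m p * (real (k r) - real (k (r - 1))) - p r * (real (k r) - real (k (r - 1))))"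
      using n by (simp add: cut_penalty_def left_diff_distrib)
    also have "\<dots> = p_max m p * real n - (\<Sum>r=1..m. p r * (real (k r) - real (k (r - 1))))"
      using n' by (simp only: sum_subtractf sum_distrib_left[symmetric])
    finally have pen: "cut_penalty m p n k * sqrt (real n) = p_max m p * real n - (\<Sum>r=1..m. p r * (real (k r) - real (k (r - 1))))" .
    have "(- cut_penalty m p n k + (\<Sum>j<n. \<Sum>i\<in>{1..m-1}. cut_weight m p k j i * letter_step m \<alpha> p n (x (j + 1)) i)) * sqrt (real n)
      = real (\<Sum>r=1..m. card {j \<in> {k (r - 1)<..k r}. x j = \<alpha> r}) - p_max m p * real n"
      unfolding distrib_right main using pen by simp
    from this[symmetric] show ?thesis
      using n by (subst divide_eq_eq) auto
  qed
  define h where "h l = (real l - p_max m p * real n) / sqrt (real n)" for l :: nat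
  have "mono h"
    by (auto simp: mono_def h_def intro!: divide_right_mono)
  have LI: "LI x n = Max ((\<lambda>k. \<Sum>r=1..m. card {j \<in> {k (r - 1)<..k r}. x j = \<alpha> r}) ` cuts m n)"
    using x by (intro LI_eq_Max_cuts[OF m \<alpha>]) auto
  have "h (LI x n) = Max (h ` ((\<lambda>k. \<Sum>r=1..m. card {j \<in> {k (r - 1)<..k r}. x j = \<alpha> r}) ` cuts m n))"
    unfolding LI by (rule mono_Max_commute[OF \<open>mono h\<close>]) (use cuts_nonempty[OF m] in \<open>auto simp: finite_cuts\<close>)
  also have "h ` ((\<lambda>k. \<Sum>r=1..m. card {j \<in> {k (r - 1)<..k r}. x j = \<alpha> r}) ` cuts m n)
    = (\<lambda>k. - cut_penalty m p n k + (\<Sum>j<n. \<Sum>i\<in>{1..m-1}. cut_weight m p k j i * letter_step m \<alpha> p n (x (j + 1)) i)) ` cuts m n"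
    unfolding image_image h_def by (intro image_cong refl key)
  finally show ?thesis
    by (simp add: h_def cut_max_def)
qed

section \<open>Convergence in distribution\<close>

lemma cut_max_cong:
  assumes "\<And>j i. j < n \<Longrightarrow> i \<in> {1..m-1} \<Longrightarrow> y j i = y' j i"
  shows "cut_max m p n y = cut_max m p n y'"
  unfolding cut_max_def using assms
  by (intro arg_cong[where f = Max] image_cong refl arg_cong2[where f = "(+)"] sum.cong) auto

lemma cut_max_measurable:
  assumes m: "1 \<le> m"
  shows "cut_max m p n \<in> borel_measurable (\<Pi>\<^sub>M j\<in>{..<n}. \<Pi>\<^sub>M i\<in>{1..m-1}. borel)"
proof -
  have [measurable]: "(\<lambda>x. x j i) \<in> borel_measurable (\<Pi>\<^sub>M j\<in>{..<n}. \<Pi>\<^sub>M i\<in>{1..m-1}. borel :: real measure)"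
    if "j \<in> {..<n}" "i \<in> {1..m-1}" for j i
    using that by (intro measurable_compose[OF measurable_component_singleton[of j]]) auto
  show ?thesis
    unfolding cut_max_def[abs_def] using cuts_nonempty[OF m] finite_cuts
    by (intro borel_measurable_Max) measurable
qed

text \<open>The increments of a path telescope, so the cut weights evaluate it at the grid points \<open>k i / n\<close> and at \<open>1\<close>.\<close>

lemma cut_max_path_increments:
  assumes m: "1 \<le> m" and n: "0 < n" and b0: "\<And>i. i \<in> {1..m-1} \<Longrightarrow> b i 0 = 0"
  shows "cut_max m p n (\<lambda>j i. b i (real (j + 1) / real n) - b i (real j / real n))
    = - (1 / real m) * (\<Sum>i=1..m-1. real i * sigma p i * b i 1)
      + Max ((\<lambda>k. (\<Sum>i=1..m-1. sigma p i * b i (real (k i) / real n)) - cut_penalty m p n k) ` cuts m n)"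
proof -
  let ?c = "- (1 / real m) * (\<Sum>i=1..m-1. real i * sigma p i * b i 1)"
  have "(\<Sum>j<n. \<Sum>i\<in>{1..m-1}. cut_weight m p k j i * (b i (real (j + 1) / real n) - b i (real j / real n)))
      = (\<Sum>i=1..m-1. sigma p i * b i (real (k i) / real n)) + ?c"
    if k: "k \<in> cuts m n" for k
  proof -
    have "(\<Sum>j<n. cut_weight m p k j i * (b i (real (j + 1) / real n) - b i (real j / real n)))
        = sigma p i * b i (real (k i) / real n) - 1 / real m * (real i * sigma p i * b i 1)"
      if i: "i \<in> {1..m-1}" for i
    proof -
      let ?d = "\<lambda>j. b i (real (Suc j) / real n) - b i (real j / real n)"
      have tele: "(\<Sum>j<l. ?d j) = b i (real l / real n)" for l
        using b0[OF i] by (subst sum_lessThan_telescope) simp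
      have "k i \<le> n"
        using k i by (auto simp: cuts_def)
      then have "(\<Sum>j<n. of_bool (j < k i) * ?d j) = (\<Sum>j<k i. ?d j)"
        by (intro sum.mono_neutral_cong_right) auto
      moreover have "cut_weight m p k j i * d = sigma p i * (of_bool (j < k i) * d) - real i / real m * sigma p i * d" for j d
        by (simp add: cut_weight_def algebra_simps)
      ultimately have "(\<Sum>j<n. cut_weight m p k j i * ?d j) = sigma p i * (\<Sum>j<k i. ?d j) - real i / real m * sigma p i * (\<Sum>j<n. ?d j)"
        by (simp only: sum_subtractf sum_distrib_left[symmetric])
      then show ?thesis
        unfolding tele using n by simp
    qed
    then show ?thesis
      by (subst sum.swap) (simp add: sum_subtractf sum_distrib_left sum_negf)
  qed
  then have "cut_max m p n (\<lambda>j i. b i (real (j + 1) / real n) - b i (real j / real n))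
    = Max ((\<lambda>k. (\<Sum>i=1..m-1. sigma p i * b i (real (k i) / real n)) - cut_penalty m p n k + ?c) ` cuts m n)"
    unfolding cut_max_def by (intro arg_cong[where f = Max] image_cong) auto
  also have "\<dots> = Max ((\<lambda>k. (\<Sum>i=1..m-1. sigma p i * b i (real (k i) / real n)) - cut_penalty m p n k) ` cuts m n) + ?c"
    using cuts_nonempty[OF m] by (intro Max_add_commute) (auto simp: finite_cuts)
  finally show ?thesis
    by simp
qed

text \<open>The limit with the maximum taken over the grid and the constraint replaced by the penalty. The values
  \<open>B i t\<close> themselves enter rather than increments, so that convergence to the limit holds on the whole
  space, which also yields the measurability of the limit.\<close>

definition grid_rv :: "nat \<Rightarrow> (nat \<Rightarrow> real) \<Rightarrow> (nat \<Rightarrow> real \<Rightarrow> 'b \<Rightarrow> real) \<Rightarrow> nat \<Rightarrow> 'b \<Rightarrow> real" where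
  "grid_rv m p B n \<omega> = - (1 / real m) * (\<Sum>i=1..m-1. real i * sigma p i * B i 1 \<omega>)
      + Max ((\<lambda>k. (\<Sum>i=1..m-1. sigma p i * B i (real (k i) / real n) \<omega>) - cut_penalty m p n k) ` cuts m n)"

lemma grid_rv_tendsto:
  assumes m: "1 \<le> m" and B: "brownian_motion N {1..m-1} M B" and \<omega>: "\<omega> \<in> space N"
  shows "(\<lambda>n. grid_rv m p B n \<omega>) \<longlonglongrightarrow> limit_rv m p B \<omega>"
proof -
  have ub: "p r \<le> p_max m p" if "r \<in> {1..m}" for r
    unfolding p_max_def using that by (intro Max_ge) auto
  obtain r0 where r0: "r0 \<in> {1..m}" "p r0 = p_max m p"
    using Max_in[of "p ` {1..m}"] m unfolding p_max_def by fastforce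
  have cont: "continuous_on {0..1} (\<lambda>t. sigma p i * B i t \<omega>)" if "i \<in> {1..m-1}" for i
    using B that \<omega> by (intro continuous_on_mult_left) (simp add: brownian_motion_def)
  have "(\<lambda>n. Max ((\<lambda>k. (\<Sum>i=1..m-1. sigma p i * B i (real (k i) / real n) \<omega>) - cut_penalty m p n k) ` cuts m n))
      \<longlonglongrightarrow> (SUP t\<in>time_points m p. \<Sum>i=1..m-1. sigma p i * B i (t i) \<omega>)"
    unfolding cut_penalty_def time_points_def
    using ub r0 by (intro penalised_grid_max_tendsto[OF cont]) (auto simp: I_star_def order_less_le)
  then show ?thesis
    unfolding grid_rv_def limit_rv_def by (intro tendsto_add tendsto_const)
qed

lemma grid_rv_measurable:
  assumes m: "1 \<le> m" and B: "brownian_motion N {1..m-1} M B"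
  shows "grid_rv m p B n \<in> borel_measurable N"
proof -
  have [measurable]: "B i t \<in> borel_measurable N" if "i \<in> {1..m-1}" "t \<in> {0..1}" for i t
    using brownian_motion_measurable[OF B] that .
  have grid: "real (k i) / real n \<in> {0..1}" if "k \<in> cuts m n" "i \<in> {1..m-1}" for k i
  proof -
    have "k i \<le> n"
      using that by (auto simp: cuts_def)
    then show ?thesis
      by (cases "n = 0") auto
  qed
  have "(\<lambda>\<omega>. (\<Sum>i=1..m-1. sigma p i * B i (real (k i) / real n) \<omega>) - cut_penalty m p n k) \<in> borel_measurable N"
    if "k \<in> cuts m n" for k
    using grid[OF that] by measurable
  then have "(\<lambda>\<omega>. Max ((\<lambda>k. (\<Sum>i=1..m-1. sigma p i * B i (real (k i) / real n) \<omega>) - cut_penalty m p n k) ` cuts m n)) \<in> borel_measurable N"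
    using cuts_nonempty[OF m] by (intro borel_measurable_Max) (auto simp: finite_cuts)
  then show ?thesis
    unfolding grid_rv_def[abs_def] by (intro borel_measurable_add borel_measurable_times borel_measurable_sum) auto
qed

lemma limit_rv_measurable:
  assumes m: "1 \<le> m" and B: "brownian_motion N {1..m-1} M B"
  shows "limit_rv m p B \<in> borel_measurable N"
  by (rule borel_measurable_LIMSEQ_real[OF grid_rv_tendsto[OF assms] grid_rv_measurable[OF assms]])

text \<open>Almost surely the paths start at \<open>0\<close>, and then \<open>grid_rv\<close> is \<open>cut_max\<close> of the grid increments.\<close>

lemma grid_rv_law:
  assumes m: "1 \<le> m" and B: "brownian_motion N {1..m-1} M B" and n: "0 < n"
    and f[measurable]: "f \<in> borel_measurable borel"
  shows "(\<integral>\<omega>. f (grid_rv m p B n \<omega>) \<partial>N) = (\<integral>y. (f (cut_max m p n y) :: real)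
    \<partial>(\<Pi>\<^sub>M j\<in>{..<n}. distr N (\<Pi>\<^sub>M i\<in>{1..m-1}. borel) (increment {1..m-1} B 0 (1 / real n))))"
proof -
  let ?I = "{1..m-1}" and ?E = "\<Pi>\<^sub>M i\<in>{1..m-1}. borel :: real measure"
  let ?inc = "\<lambda>\<omega>. \<lambda>j\<in>{..<n}. increment {1..m-1} B (real j / real n) (real (j + 1) / real n) \<omega>"
  have inc: "?inc \<in> N \<rightarrow>\<^sub>M (\<Pi>\<^sub>M j\<in>{..<n}. ?E)"
    using n by (intro measurable_restrict increment_measurable[OF B]) auto
  note cm[measurable] = cut_max_measurable[OF m, of p n]
  have fc: "(\<lambda>y. f (cut_max m p n y)) \<in> borel_measurable (\<Pi>\<^sub>M j\<in>{..<n}. ?E)"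
    by measurable
  have "AE \<omega> in N. \<forall>i\<in>?I. B i 0 \<omega> = 0"
    using B by (simp add: brownian_motion_def AE_finite_all)
  then have "AE \<omega> in N. f (grid_rv m p B n \<omega>) = f (cut_max m p n (?inc \<omega>))"
  proof eventually_elim
    case (elim \<omega>)
    have "cut_max m p n (?inc \<omega>) = cut_max m p n (\<lambda>j i. B i (real (j + 1) / real n) \<omega> - B i (real j / real n) \<omega>)"
      by (rule cut_max_cong) (simp add: increment_def)
    also have "\<dots> = grid_rv m p B n \<omega>"
      unfolding grid_rv_def using elim by (intro cut_max_path_increments[OF m n]) auto
    finally show ?case
      by simp
  qed
  then have "(\<integral>\<omega>. f (grid_rv m p B n \<omega>) \<partial>N) = (\<integral>\<omega>. f (cut_max m p n (?inc \<omega>)) \<partial>N)"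
    using measurable_compose[OF grid_rv_measurable[OF m B] f] measurable_compose[OF inc fc]
    by (intro integral_cong_AE)
  also have "\<dots> = (\<integral>y. f (cut_max m p n y) \<partial>distr N (\<Pi>\<^sub>M j\<in>{..<n}. ?E) ?inc)"
    by (rule integral_distr[OF inc fc, symmetric])
  finally show ?thesis
    unfolding brownian_grid_increments[OF B n] .
qed

text \<open>The sequence is indexed from \<open>1\<close> and the coordinates of the product from \<open>0\<close>; the shift is carried out on
  the infinite product measure.\<close>

lemma iid_steps_law:
  assumes P: "prob_space P" and X: "prob_space.indep_vars P (\<lambda>_. S) X {1..}"
    and iid: "\<And>i::nat. 1 \<le> i \<Longrightarrow> distr P S (X i) = distr P S (X 1)"
    and \<psi>: "\<psi> \<in> S \<rightarrow>\<^sub>M E"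
  shows "distr P (\<Pi>\<^sub>M j\<in>{..<n}. E) (\<lambda>\<omega>. \<lambda>j\<in>{..<n}. \<psi> (X (j + 1) \<omega>)) = (\<Pi>\<^sub>M j\<in>{..<n}. distr P E (\<lambda>\<omega>. \<psi> (X 1 \<omega>)))"
proof -
  interpret prob_space P by fact
  let ?Z = "\<lambda>i \<omega>. \<psi> (X i \<omega>)" and ?\<mu> = "distr P E (\<lambda>\<omega>. \<psi> (X 1 \<omega>))"
  have Xm: "X i \<in> P \<rightarrow>\<^sub>M S" if "1 \<le> i" for i
    using X that by (auto simp: indep_vars_def)
  have Zm: "?Z i \<in> P \<rightarrow>\<^sub>M E" if "1 \<le> i" for i
    using measurable_compose[OF Xm[OF that] \<psi>] .
  have indep: "indep_vars (\<lambda>_. E) ?Z {1..}"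
    by (rule indep_vars_compose2[OF X \<psi>])
  have law: "distr P E (?Z i) = ?\<mu>" if "1 \<le> i" for i
    using iid[OF that] distr_distr[OF \<psi> Xm[OF that]] distr_distr[OF \<psi> Xm[of 1]] by (simp add: comp_def)
  have all: "distr P (\<Pi>\<^sub>M i\<in>{1..}. E) (\<lambda>\<omega>. \<lambda>i\<in>{1..}. ?Z i \<omega>) = (\<Pi>\<^sub>M i\<in>{1..}. ?\<mu>)"
  proof -
    have "distr P (\<Pi>\<^sub>M i\<in>{1..}. E) (\<lambda>\<omega>. \<lambda>i\<in>{1..}. ?Z i \<omega>) = (\<Pi>\<^sub>M i\<in>{1..}. distr P E (?Z i))"
      using indep Zm by (subst (asm) indep_vars_iff_distr_eq_PiM') auto
    also have "\<dots> = (\<Pi>\<^sub>M i\<in>{1..}. ?\<mu>)"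
      by (intro PiM_cong refl law) simp
    finally show ?thesis .
  qed
  have Zall: "(\<lambda>\<omega>. \<lambda>i\<in>{1..}. ?Z i \<omega>) \<in> P \<rightarrow>\<^sub>M (\<Pi>\<^sub>M i\<in>{1..}. E)"
    using Zm by (intro measurable_restrict) auto
  have shift: "(\<lambda>\<omega>. \<lambda>j\<in>{..<n}. \<omega> (Suc j)) \<in> (\<Pi>\<^sub>M i\<in>{1..}. E) \<rightarrow>\<^sub>M (\<Pi>\<^sub>M j\<in>{..<n}. E)"
    by (intro measurable_restrict measurable_component_singleton) auto
  have "distr P (\<Pi>\<^sub>M j\<in>{..<n}. E) (\<lambda>\<omega>. \<lambda>j\<in>{..<n}. ?Z (j + 1) \<omega>)
      = distr (distr P (\<Pi>\<^sub>M i\<in>{1..}. E) (\<lambda>\<omega>. \<lambda>i\<in>{1..}. ?Z i \<omega>)) (\<Pi>\<^sub>M j\<in>{..<n}. E) (\<lambda>\<omega>. \<lambda>j\<in>{..<n}. \<omega> (Suc j))"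
    unfolding distr_distr[OF shift Zall] by (intro distr_cong) (auto simp: restrict_def fun_eq_iff)
  also have "\<dots> = distr (\<Pi>\<^sub>M i\<in>{1..}. ?\<mu>) (\<Pi>\<^sub>M j\<in>{..<n}. ?\<mu>) (\<lambda>\<omega>. \<lambda>j\<in>{..<n}. \<omega> (Suc j))"
    unfolding all by (intro distr_cong sets_PiM_cong) auto
  also have "\<dots> = (\<Pi>\<^sub>M j\<in>{..<n}. ?\<mu>)"
    using prob_space_distr[OF Zm[of 1]] by (intro distr_PiM_reindex) auto
  finally show ?thesis .
qed

text \<open>With \<open>b = n powr (1 / 8)\<close> the swapping error is of order \<open>b\<^sup>2 / sqrt n = n powr (- 1 / 4)\<close> and the smoothing
  error of order \<open>ln n / n powr (1 / 8)\<close>. Every positive exponent below \<open>1 / 4\<close> would do.\<close>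

lemma lindeberg_error_tendsto_0:
  fixes L A C D :: real
  shows "(\<lambda>n. real n * (6 * L * (real n powr (1/8))\<^sup>2 * A ^ 3 * (C * sqrt (1 / real n) ^ 3))
      + 2 * (L * (D * ln (real n + 1) / real n powr (1/8)))) \<longlonglongrightarrow> 0"
proof -
  have 1: "(\<lambda>n. real n * ((real n powr (1/8))\<^sup>2 * sqrt (1 / real n) ^ 3)) \<longlonglongrightarrow> 0"
    by real_asymp
  have 2: "(\<lambda>n. ln (real n + 1) / real n powr (1/8)) \<longlonglongrightarrow> 0"
    by real_asymp
  have "(\<lambda>n. (6 * L * A ^ 3 * C) * (real n * ((real n powr (1/8))\<^sup>2 * sqrt (1 / real n) ^ 3))
      + (2 * L * D) * (ln (real n + 1) / real n powr (1/8)))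
      \<longlonglongrightarrow> (6 * L * A ^ 3 * C) * 0 + (2 * L * D) * 0"
    by (intro tendsto_add tendsto_mult tendsto_const 1 2)
  then show ?thesis
    by (simp add: mult_ac)
qed


text \<open>For a smooth test function, Lindeberg's method passes from the letters to the grid increments of the
  Brownian motion, and dominated convergence along each path passes from the grid to the limit.\<close>

lemma LI_expectation_tendsto:
  fixes P :: "'a measure" and X :: "nat \<Rightarrow> 'a \<Rightarrow> 'c::linorder" and f f1 f2 f3 :: "real \<Rightarrow> real"
  assumes P: "prob_space P" and m: "1 \<le> m" and \<alpha>: "strict_mono_on {1..m} \<alpha>"
    and X: "prob_space.indep_vars P (\<lambda>_. count_space (\<alpha> ` {1..m})) X {1..}"
    and iid: "\<And>i. 1 \<le> i \<Longrightarrow> distr P (count_space (\<alpha> ` {1..m})) (X i) = distr P (count_space (\<alpha> ` {1..m})) (X 1)"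
    and Xp: "\<And>r. r \<in> {1..m} \<Longrightarrow> measure P {\<omega> \<in> space P. X 1 \<omega> = \<alpha> r} = p r"
    and p: "\<And>r. r \<in> {1..m} \<Longrightarrow> 0 < p r \<and> p r < 1" "(\<Sum>r=1..m. p r) = 1"
    and B: "brownian_motion N {1..m-1} (rho p) B"
    and f: "\<And>u. (f has_real_derivative f1 u) (at u)"
      "\<And>u. (f1 has_real_derivative f2 u) (at u)"
      "\<And>u. (f2 has_real_derivative f3 u) (at u)"
    and L: "\<And>u. \<bar>f u\<bar> \<le> L" "\<And>u. \<bar>f1 u\<bar> \<le> L" "\<And>u. \<bar>f2 u\<bar> \<le> L" "\<And>u. \<bar>f3 u\<bar> \<le> L"
  defines "W \<equiv> \<lambda>n \<omega>. (real (LI (\<lambda>i. X i \<omega>) n) - p_max m p * real n) / sqrt (real n)"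
  shows "W n \<in> borel_measurable P"
    and "(\<lambda>n. \<integral>\<omega>. f (W n \<omega>) \<partial>P) \<longlonglongrightarrow> (\<integral>\<omega>. f (limit_rv m p B \<omega>) \<partial>N)"
proof -
  interpret P: prob_space P by fact
  interpret N: prob_space N
    using B by (simp add: brownian_motion_def)
  define I where "I = {1..m-1}"
  define E where "E = (\<Pi>\<^sub>M i\<in>I. borel :: real measure)"
  define step where "step n j \<omega> = letter_step m \<alpha> p n (X (j + 1) \<omega>)" for n j \<omega>
  define \<mu> where "\<mu> n = distr P E (\<lambda>\<omega>. letter_step m \<alpha> p n (X 1 \<omega>))" for n
  define \<nu> where "\<nu> n = distr N E (increment I B 0 (1 / real n))" for n
  have fm[measurable]: "f \<in> borel_measurable borel"
    using f(1) by (intro borel_measurable_continuous_onI DERIV_continuous_on) auto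
  have Xm: "X i \<in> P \<rightarrow>\<^sub>M count_space (\<alpha> ` {1..m})" if "1 \<le> i" for i
    using X that by (auto simp: P.indep_vars_def)
  have letters: "letter_step m \<alpha> p n \<in> count_space (\<alpha> ` {1..m}) \<rightarrow>\<^sub>M E" for n
    by (auto simp: letter_step_def E_def I_def space_PiM)
  have steps_meas: "(\<lambda>\<omega>. \<lambda>j\<in>{..<n}. step n j \<omega>) \<in> P \<rightarrow>\<^sub>M (\<Pi>\<^sub>M j\<in>{..<n}. E)" for n
    unfolding step_def by (intro measurable_restrict measurable_compose[OF Xm letters]) auto
  note cm[measurable] = cut_max_measurable[OF m, of p, folded I_def E_def]
  have W: "W n \<omega> = cut_max m p n (\<lambda>j\<in>{..<n}. step n j \<omega>)" if "0 < n" "\<omega> \<in> space P" for n \<omega>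
  proof -
    have "X j \<omega> \<in> \<alpha> ` {1..m}" if "j \<in> {1..n}" for j
      using measurable_space[OF Xm[of j] \<open>\<omega> \<in> space P\<close>] that by simp
    then have "W n \<omega> = cut_max m p n (\<lambda>j. step n j \<omega>)"
      unfolding W_def step_def using \<open>0 < n\<close> by (intro LI_eq_cut_max m \<alpha> p)
    also have "\<dots> = cut_max m p n (\<lambda>j\<in>{..<n}. step n j \<omega>)"
      by (rule cut_max_cong) simp
    finally show ?thesis .
  qed
  show Wm: "W n \<in> borel_measurable P" for n
  proof (cases "n = 0")
    case True
    then show ?thesis
      by (simp add: W_def[abs_def])
  next
    case False
    then have "W n \<in> borel_measurable P \<longleftrightarrow> (\<lambda>\<omega>. cut_max m p n (\<lambda>j\<in>{..<n}. step n j \<omega>)) \<in> borel_measurable P"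
      using W by (intro measurable_cong) auto
    then show ?thesis
      using measurable_compose[OF steps_meas cm] by simp
  qed
  \<comment> \<open>\<open>C * sqrt (1 / n) ^ 3\<close> bounds the third moments of the letter steps and of the Brownian increments.\<close>
  define C where "C = (\<Sum>i\<in>I. 2 / sigma p i) ^ 3 + real (card I) ^ 3 * (real (card I) * 2)"
  define A where "A = (\<Sum>i\<in>I. sigma p i)"
  have \<sigma>: "0 < sigma p i" if "i \<in> I" for i
    using that p(1)[of i] p(1)[of "i + 1"] by (intro sigma_pos) (auto simp: I_def)
  have L0: "0 \<le> L"
    using L(1)[of 0] by linarith
  define err where "err n = real n * (6 * L * (real n powr (1/8))\<^sup>2 * A ^ 3 * (C * sqrt (1 / real n) ^ 3))
      + 2 * (L * (real (m + 1) * ln (real n + 1) / real n powr (1/8)))" for n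
  have bound: "\<bar>(\<integral>\<omega>. f (W n \<omega>) \<partial>P) - (\<integral>\<omega>. f (grid_rv m p B n \<omega>) \<partial>N)\<bar> \<le> err n" if n: "0 < n" for n
  proof -
    have fc: "(\<lambda>y. f (cut_max m p n y)) \<in> borel_measurable (\<Pi>\<^sub>M j\<in>{..<n}. E)"
      by measurable
    have "(\<integral>\<omega>. f (W n \<omega>) \<partial>P) = (\<integral>\<omega>. f (cut_max m p n (\<lambda>j\<in>{..<n}. step n j \<omega>)) \<partial>P)"
      using W[OF n] by (intro Bochner_Integration.integral_cong) auto
    also have "\<dots> = (\<integral>y. f (cut_max m p n y) \<partial>distr P (\<Pi>\<^sub>M j\<in>{..<n}. E) (\<lambda>\<omega>. \<lambda>j\<in>{..<n}. step n j \<omega>))"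
      by (rule integral_distr[OF steps_meas fc, symmetric])
    also have "distr P (\<Pi>\<^sub>M j\<in>{..<n}. E) (\<lambda>\<omega>. \<lambda>j\<in>{..<n}. step n j \<omega>) = (\<Pi>\<^sub>M j\<in>{..<n}. \<mu> n)"
      unfolding step_def \<mu>_def by (rule iid_steps_law[OF P X iid letters])
    finally have XW: "(\<integral>\<omega>. f (W n \<omega>) \<partial>P) = (\<integral>y. f (cut_max m p n y) \<partial>(\<Pi>\<^sub>M j\<in>{..<n}. \<mu> n))" .
    have BW: "(\<integral>\<omega>. f (grid_rv m p B n \<omega>) \<partial>N) = (\<integral>y. f (cut_max m p n y) \<partial>(\<Pi>\<^sub>M j\<in>{..<n}. \<nu> n))"
      unfolding \<nu>_def E_def I_def by (rule grid_rv_law[OF m B n fm])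
    have h: "1 / real n \<in> {0..1}"
      using n by simp
    have unit: "rho p i i = 1" for i
      by (simp add: rho_def)
    have finI: "finite I"
      by (simp add: I_def)
    note law\<mu> = letter_step_law[OF P strict_mono_on_imp_inj_on[OF \<alpha>] Xm[OF order_refl] Xp p(1) n,
        folded I_def, folded E_def, folded \<mu>_def]
    note law\<nu> = brownian_increment_law[OF B[folded I_def] finI h unit, folded E_def, folded \<nu>_def]
    let ?\<tau> = "C * sqrt (1 / real n) ^ 3"
    have \<tau>1: "(\<integral>y. (\<Sum>i\<in>I. \<bar>y i\<bar>) ^ 3 \<partial>\<mu> n) \<le> ?\<tau>"
      unfolding C_def by (intro order_trans[OF law\<mu>(6)] mult_right_mono) auto
    have \<tau>2: "(\<integral>y. (\<Sum>i\<in>I. \<bar>y i\<bar>) ^ 3 \<partial>\<nu> n) \<le> ?\<tau>"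
    proof (rule order_trans[OF law\<nu>(6)])
      have "0 \<le> (\<Sum>i\<in>I. 2 / sigma p i) ^ 3"
        using \<sigma> by (intro zero_le_power sum_nonneg) (simp add: less_imp_le)
      then have "real (card I) ^ 3 * (real (card I) * 2) * sqrt (1 / real n) ^ 3 \<le> ?\<tau>"
        unfolding C_def by (intro mult_right_mono) auto
      then show "real (card I) ^ 3 * (real (card I) * (2 * sqrt (1 / real n) ^ 3)) \<le> ?\<tau>"
        by (simp only: mult.assoc)
    qed
    have weight: "\<bar>cut_weight m p k j i\<bar> \<le> A" if "i \<in> I" for k j i
    proof -
      have "0 \<le> real i / real m" "real i / real m \<le> 1"
        using that m by (auto simp: I_def)
      then have "\<bar>of_bool (j < k i) - real i / real m\<bar> \<le> 1"
        by (cases "j < k i") auto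
      then have "\<bar>cut_weight m p k j i\<bar> \<le> 1 * sigma p i"
        unfolding cut_weight_def abs_mult using \<sigma>[OF that] by (intro mult_mono) auto
      also have "\<dots> \<le> A"
        unfolding A_def mult_1 using that \<sigma> finI by (intro member_le_sum) (auto simp: less_imp_le)
      finally show ?thesis .
    qed
    have A0: "0 \<le> A"
      unfolding A_def using \<sigma> by (intro sum_nonneg) (simp add: less_imp_le)
    have b: "1 \<le> real n powr (1/8)"
      using n by (intro ge_one_powr_ge_zero) auto
    have "\<bar>(\<integral>y. f (cut_max m p n y) \<partial>(\<Pi>\<^sub>M j\<in>{..<n}. \<mu> n)) - (\<integral>y. f (cut_max m p n y) \<partial>(\<Pi>\<^sub>M j\<in>{..<n}. \<nu> n))\<bar>
      \<le> real n * (6 * L * (real n powr (1/8))\<^sup>2 * A ^ 3 * ?\<tau>) + 2 * (L * (ln (real (card (cuts m n))) / real n powr (1/8)))"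
      unfolding cut_max_def I_def[symmetric]
    proof (rule lindeberg_max[OF finI finite_cuts cuts_nonempty[OF m] weight A0 f L b
          law\<mu>(1) _ law\<mu>(5) \<tau>1 law\<nu>(1) _ law\<nu>(5) \<tau>2])
      show "sets (\<mu> n) = sets (\<Pi>\<^sub>M i\<in>I. borel)" "sets (\<nu> n) = sets (\<Pi>\<^sub>M i\<in>I. borel)"
        using law\<mu>(2) law\<nu>(2) by (simp_all add: E_def)
      show "(\<integral>y. y i \<partial>\<mu> n) = (\<integral>y. y i \<partial>\<nu> n)" if "i \<in> I" for i
        using law\<mu>(3) law\<nu>(3) that by simp
      show "(\<integral>y. y i * y j \<partial>\<mu> n) = (\<integral>y. y i * y j \<partial>\<nu> n)" if "i \<in> I" "j \<in> I" for i j
        using law\<mu>(4) law\<nu>(4) that by simp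
    qed
    also have "\<dots> \<le> err n"
    proof -
      have c: "0 < card (cuts m n)"
        using cuts_nonempty[OF m] finite_cuts by (simp add: card_gt_0_iff)
      have "real (card (cuts m n)) \<le> (real n + 1) ^ (m + 1)"
        using card_cuts_le[of m n] by (metis of_nat_1 of_nat_add of_nat_le_iff of_nat_power)
      then have "ln (real (card (cuts m n))) \<le> ln ((real n + 1) ^ (m + 1))"
        using c by (subst ln_le_cancel_iff) auto
      also have "\<dots> = real (m + 1) * ln (real n + 1)"
        by (rule ln_realpow)
      finally show ?thesis
        unfolding err_def using L0 b by (intro add_left_mono mult_left_mono divide_right_mono) auto
    qed
    finally show ?thesis
      unfolding XW BW .
  qed
  have "err \<longlonglongrightarrow> 0"
    unfolding err_def[abs_def] by (rule lindeberg_error_tendsto_0)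
  then have diff: "(\<lambda>n. (\<integral>\<omega>. f (W n \<omega>) \<partial>P) - (\<integral>\<omega>. f (grid_rv m p B n \<omega>) \<partial>N)) \<longlonglongrightarrow> 0"
    by (rule Lim_null_comparison[rotated])
       (use bound in \<open>auto intro!: eventually_mono[OF eventually_gt_at_top[of 0]]\<close>)
  have "(\<lambda>n. \<integral>\<omega>. f (grid_rv m p B n \<omega>) \<partial>N) \<longlonglongrightarrow> (\<integral>\<omega>. f (limit_rv m p B \<omega>) \<partial>N)"
  proof (rule integral_dominated_convergence[where w = "\<lambda>_. L"])
    have cont: "isCont f u" for u
      using f(1) by (rule DERIV_isCont)
    show "AE \<omega> in N. (\<lambda>n. f (grid_rv m p B n \<omega>)) \<longlonglongrightarrow> f (limit_rv m p B \<omega>)"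
      by (intro AE_I2 isCont_tendsto_compose[OF cont] grid_rv_tendsto[OF m B])
    show "AE \<omega> in N. norm (f (grid_rv m p B n \<omega>)) \<le> L" for n
      using L(1) by simp
    show "(\<lambda>\<omega>. f (limit_rv m p B \<omega>)) \<in> borel_measurable N"
      by (rule measurable_compose[OF limit_rv_measurable[OF m B] fm])
    show "(\<lambda>\<omega>. f (grid_rv m p B n \<omega>)) \<in> borel_measurable N" for n
      by (rule measurable_compose[OF grid_rv_measurable[OF m B] fm])
  qed simp
  then show "(\<lambda>n. \<integral>\<omega>. f (W n \<omega>) \<partial>P) \<longlonglongrightarrow> (\<integral>\<omega>. f (limit_rv m p B \<omega>) \<partial>N)"
    using diff by (rule Lim_transform)
qed

lemma char_distr_cos_sin:
  assumes M: "prob_space M" and Y[measurable]: "Y \<in> borel_measurable M"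
  shows "char (distr M borel Y) t
    = complex_of_real (\<integral>\<omega>. cos (t * Y \<omega>) \<partial>M) + \<i> * complex_of_real (\<integral>\<omega>. sin (t * Y \<omega>) \<partial>M)"
proof -
  interpret prob_space M by fact
  have int: "integrable M (\<lambda>\<omega>. cos (t * Y \<omega>))" "integrable M (\<lambda>\<omega>. sin (t * Y \<omega>))"
    by (intro integrable_const_bound[of _ 1] | simp)+
  have "char (distr M borel Y) t = (\<integral>\<omega>. iexp (t * Y \<omega>) \<partial>M)"
    by (simp add: char_def integral_distr)
  also have "\<dots> = (\<integral>\<omega>. complex_of_real (cos (t * Y \<omega>)) + \<i> * complex_of_real (sin (t * Y \<omega>)) \<partial>M)"
    by (intro Bochner_Integration.integral_cong refl) (simp add: complex_eq_iff Re_exp Im_exp)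
  also have "\<dots> = complex_of_real (\<integral>\<omega>. cos (t * Y \<omega>) \<partial>M) + \<i> * complex_of_real (\<integral>\<omega>. sin (t * Y \<omega>) \<partial>M)"
    using int by (simp add: integral_complex_of_real)
  finally show ?thesis .
qed

theorem theorem3p1:
  fixes P :: "'a measure" and X :: "nat \<Rightarrow> 'a \<Rightarrow> 'c::linorder"
    and m :: nat and \<alpha> :: "nat \<Rightarrow> 'c" and p :: "nat \<Rightarrow> real"
    and N :: "'b measure" and B :: "nat \<Rightarrow> real \<Rightarrow> 'b \<Rightarrow> real"
  assumes "prob_space P"
    and "strict_mono_on {1..m} \<alpha>"
    and "prob_space.indep_vars P (\<lambda>_. count_space (\<alpha> ` {1..m})) X {1..}"
    and "\<forall>i\<ge>1. distr P (count_space (\<alpha> ` {1..m})) (X i) = distr P (count_space (\<alpha> ` {1..m})) (X 1)"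
    and "\<forall>r\<in>{1..m}. measure P {\<omega> \<in> space P. X 1 \<omega> = \<alpha> r} = p r"
    and "\<forall>r\<in>{1..m}. 0 < p r \<and> p r < 1"
    and "(\<Sum>r=1..m. p r) = 1"
    and "brownian_motion N {1..m-1} (rho p) B"
  shows "weak_conv_m
           (\<lambda>n. distr P borel (\<lambda>\<omega>. (real (LI (\<lambda>i. X i \<omega>) n) - p_max m p * real n) / sqrt (real n)))
           (distr N borel (limit_rv m p B))"
proof -
  let ?W = "\<lambda>n \<omega>. (real (LI (\<lambda>i. X i \<omega>) n) - p_max m p * real n) / sqrt (real n)"
  have N: "prob_space N"
    using assms(8) by (simp add: brownian_motion_def)
  have m: "1 \<le> m"
    using assms(7) by (cases m) auto
  note conv = LI_expectation_tendsto[OF assms(1) m assms(2,3) assms(4)[rule_format] assms(5,6)[rule_format] assms(7,8)]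
  have Wm: "?W n \<in> borel_measurable P" for n
    by (rule conv(1)[of "\<lambda>_. 0" "\<lambda>_. 0" "\<lambda>_. 0" "\<lambda>_. 0" 0]) auto
  note lm = limit_rv_measurable[OF m assms(8), of p]
  show ?thesis
  proof (rule levy_continuity)
    show "real_distribution (distr P borel (?W n))" for n
      by (intro prob_space.real_distribution_distr assms(1) Wm)
    show "real_distribution (distr N borel (limit_rv m p B))"
      by (intro prob_space.real_distribution_distr N lm)
    fix t :: real
    \<comment> \<open>The functions \<open>u \<mapsto> cos (t * u)\<close> and \<open>u \<mapsto> sin (t * u)\<close> and their derivatives up to order 3 are bounded by \<open>L\<close>.\<close>
    define L where "L = max 1 (\<bar>t\<bar> ^ 3)"
    have L: "1 \<le> L" "\<bar>t\<bar> \<le> L" "\<bar>t\<bar> ^ 2 \<le> L" "\<bar>t\<bar> ^ 3 \<le> L"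
    proof -
      show "1 \<le> L" "\<bar>t\<bar> ^ 3 \<le> L"
        by (auto simp: L_def)
      have "\<bar>t\<bar> \<le> L \<and> \<bar>t\<bar> ^ 2 \<le> L"
      proof (cases "\<bar>t\<bar> \<le> 1")
        case True
        then show ?thesis
          using power_le_one[of "\<bar>t\<bar>" 2] by (auto simp: L_def)
      next
        case False
        then show ?thesis
          using power_increasing[of 1 3 "\<bar>t\<bar>"] power_increasing[of 2 3 "\<bar>t\<bar>"] by (auto simp: L_def)
      qed
      then show "\<bar>t\<bar> \<le> L" "\<bar>t\<bar> ^ 2 \<le> L"
        by auto
    qed
    have trig: "\<bar>c * s\<bar> \<le> L" if "\<bar>c\<bar> \<le> L" "\<bar>s\<bar> \<le> 1" for c s :: real
      using mult_mono[OF that] that(1) by (simp add: abs_mult)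
    have tL: "\<bar>- t\<bar> \<le> L" "\<bar>t\<bar> \<le> L" "\<bar>- (t ^ 2)\<bar> \<le> L" "\<bar>t ^ 3\<bar> \<le> L" "\<bar>- (t ^ 3)\<bar> \<le> L"
      using L by (auto simp: power_abs)
    have "(\<lambda>n. \<integral>\<omega>. cos (t * ?W n \<omega>) \<partial>P) \<longlonglongrightarrow> (\<integral>\<omega>. cos (t * limit_rv m p B \<omega>) \<partial>N)"
    proof (rule conv(2))
      show "((\<lambda>u. cos (t * u)) has_real_derivative - t * sin (t * u)) (at u)"
        "((\<lambda>u. - t * sin (t * u)) has_real_derivative - (t ^ 2) * cos (t * u)) (at u)"
        "((\<lambda>u. - (t ^ 2) * cos (t * u)) has_real_derivative t ^ 3 * sin (t * u)) (at u)" for u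
        by (auto intro!: derivative_eq_intros simp: eval_nat_numeral)
      show "\<bar>cos (t * u)\<bar> \<le> L" "\<bar>- t * sin (t * u)\<bar> \<le> L" "\<bar>- (t ^ 2) * cos (t * u)\<bar> \<le> L"
        "\<bar>t ^ 3 * sin (t * u)\<bar> \<le> L" for u
        using order_trans[OF abs_cos_le_one L(1)] by (intro trig tL abs_cos_le_one abs_sin_le_one | simp)+
    qed
    moreover have "(\<lambda>n. \<integral>\<omega>. sin (t * ?W n \<omega>) \<partial>P) \<longlonglongrightarrow> (\<integral>\<omega>. sin (t * limit_rv m p B \<omega>) \<partial>N)"
    proof (rule conv(2))
      show "((\<lambda>u. sin (t * u)) has_real_derivative t * cos (t * u)) (at u)"
        "((\<lambda>u. t * cos (t * u)) has_real_derivative - (t ^ 2) * sin (t * u)) (at u)"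
        "((\<lambda>u. - (t ^ 2) * sin (t * u)) has_real_derivative - (t ^ 3) * cos (t * u)) (at u)" for u
        by (auto intro!: derivative_eq_intros simp: eval_nat_numeral)
      show "\<bar>sin (t * u)\<bar> \<le> L" "\<bar>t * cos (t * u)\<bar> \<le> L" "\<bar>- (t ^ 2) * sin (t * u)\<bar> \<le> L"
        "\<bar>- (t ^ 3) * cos (t * u)\<bar> \<le> L" for u
        using order_trans[OF abs_sin_le_one L(1)] by (intro trig tL abs_cos_le_one abs_sin_le_one | simp)+
    qed
    ultimately show "(\<lambda>n. char (distr P borel (?W n)) t) \<longlonglongrightarrow> char (distr N borel (limit_rv m p B)) t"
      unfolding char_distr_cos_sin[OF assms(1) Wm] char_distr_cos_sin[OF N lm]
      by (intro tendsto_add tendsto_mult tendsto_const tendsto_of_real)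
  qed
qed

end
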